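(* Assume $(H^{MFG}_1)$, $(H^{MFG}_2)$, let $C\ge\tilde C$, let $\mu\in\mathcal P_{m_0}(\tilde\Gamma_C)$ be a constrained MFG equilibrium and $u$ the associated value function. Set $\ell_i(x,t)=L_i[m^\mu(t)](x,t)$, $\ell_*(t)=L_*[m^\mu(t)](t)$, $g=G[m^\mu(T)]$. Then $u(x,T)=g(x)$ for all $x\in\mathcal G$ and, for every $(x,t)\in\mathcal G\times(0,T)$ and every $\varphi\in C^1(\mathcal G\times[0,T])$ such that $u-\varphi$ has a local maximum (resp. local minimum) at $(x,t)$, one has $-\partial_t\varphi(x,t)+H_i(x,t,D\varphi(x,t))\le0$ (resp. $\ge0$) if $x\in J_i\setminus\{O\}$, and $-\partial_t\varphi(O,t)+H_O(t,D\varphi(O,t))\le0$ (resp. $\ge0$) if $x=O$; i.e. $u$ is a viscosity solution of $-\partial_tu+H_i(x,t,Du)=0$ in $J_i\setminus\{O\}$, $-\partial_tu+H_O(t,Du)=0$ at $O$, $u(\cdot,T)=g$.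
   Context: Let $N\ge 2$, $d\ge 1$, $e_1,\dots,e_N\in\mathbb R^d$ pairwise distinct unit vectors, $J_i=\{s e_i:s\ge0\}$, $\mathcal G=\bigcup_i J_i$, $O=0$, with geodesic distance $d(x,y)=|x-y|$ if $x,y$ lie in a common $J_i$ and $|x|+|y|$ otherwise. Fix $T>0$. Controls: $A_i=\{i\}\times\mathbb R$ ($i=0,\dots,N$), $A=\bigcup A_i$, $|(i,\bar a)|=|\bar a|$; $M=\{(x,a): a\in A_i \text{ if } x\in J_i\setminus\{O\},\ a\in A \text{ if } x=O\}$; $f(x,(i,\bar a))=\bar a e_i$ ($i\ge1$), $f(O,(0,\bar a))=0$. $\Gamma_t[x]$: pairs $(y,\alpha)$, $y\in W^{1,2}([t,T];\mathcal G)$, $\alpha:[t,T]\to A$ measurable, $(y,\alpha)\in M$ a.e., $\int|\alpha|^2<\infty$, $y(s)=x+\int_t^s f(y,\alpha)d\tau$; $\Gamma[x]=\Gamma_0[x]$. $\tilde F(x)=\mathbb Re_i$ on $J_i\setminus\{O\}$, $\tilde F(O)=\bigcup_i\mathbb Re_i$; $Y_{x,0}=\{y\in W^{1,2}([0,T];\mathcal G):\dot y\in\tilde F(y)\text{ a.e.}, y(0)=x\}$; $\tilde\Gamma_C[x]=\{y\in Y_{x,0}: d(y(s),O)\le C\ \forall s,\ \|\dot y\|_2\le C\}$, $\tilde\Gamma_C=\bigcup_x\tilde\Gamma_C[x]$ (uniform topology). For $y\in\tilde\Gamma_C[x]$, $\alpha_y$ is the control with $(y,\alpha_y)\in\Gamma[x]$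 and $\alpha_y(t)=(0,0)\in A_0$ for a.e. $t$ with $y(t)=O$. $\mathcal P(X)$: Borel probability measures with narrow topology; $e_t(y)=y(t)$, $m^\mu(t)=e_t\sharp\mu$. MFG costs: for $i=1,\dots,N$, $L_i:\mathcal P(\mathcal G)\to C(\mathcal G\times[0,T])$, $L_*:\mathcal P(\mathcal G)\to C([0,T])$, $G_i:\mathcal P(\mathcal G)\to C(\mathcal G)$, $G_*:\mathcal P(\mathcal G)\to\mathbb R$ continuous (sup norms). $(H^{MFG}_1)$: $K:=\max\big(\sup_m\|L_*[m]\|_\infty,\max_i\sup_m\|L_i[m]\|_\infty,\sup_m|G_*[m]|,\max_i\sup_m\|G_i[m]\|_\infty\big)<\infty$. $(H^{MFG}_2)$: $m_0\in\mathcal P(\mathcal G)$ has compact support. $L[m](x,t)=L_i[m](x,t)$ on $J_i\setminus\{O\}$, $L[m](O,t)=\min\{L_*[m](t),\min_iL_i[m](O,t)\}$; $G[m](x)=G_i[m](x)$ on $J_i\setminus\{O\}$, $G[m](O)=\min\{G_*[m],\min_iG_i[m](O)\}$. $J^\mu(x;(y,\alpha))=\int_0^T\big(L[m^\mu(\tau)](y,\tau)+\tfrac12|\alpha|^2\big)d\tau+G[m^\mu(T)](y(T))$; $\tilde\Gamma_C^{\mu,{\rm opt}}[x]=\{y\in\tilde\Gamma_C[x]: J^\mu(x;(y,\alpha_y))=\min_{\Gamma[x]}J^\mu(x;\cdot)\}$. $\tilde C>0$ is a constant (existing by the hypotheses) such that for all $C>0$, $\mu\in\mathcal P(\tilde\Gamma_C)$,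 $x\in\mathrm{supp}(m_0)$ and minimizers $(y,\alpha)$ of $J^\mu(x;\cdot)$ over $\Gamma[x]$: $\|\alpha\|_2\le\tilde C$ and $y\in\tilde\Gamma_{\tilde C}[x]$. $\mathcal P_{m_0}(\tilde\Gamma_C)=\{\mu\in\mathcal P(\tilde\Gamma_C):e_0\sharp\mu=m_0\}$; $\mu$ is a constrained MFG equilibrium if $\mu\in\mathcal P_{m_0}(\tilde\Gamma_C)$ and $\mathrm{supp}(\mu)\subset\bigcup_{x\in\mathrm{supp}(m_0)}\tilde\Gamma_C^{\mu,{\rm opt}}[x]$. Associated value function: with $\ell_O(t)=\min\{\ell_*(t),\min_i\ell_i(O,t)\}$ and $L(x,t)=L[m^\mu(t)](x,t)$, $u(x,t)=\inf_{(y,\alpha)\in\Gamma_t[x]}\big\{\int_t^T\big(L(y(\tau),\tau)+\tfrac12|\alpha(\tau)|^2\big)d\tau+g(y(T))\big\}$ for $t<T$, $u(x,T)=g(x)$. $C^1(\mathcal G\times[0,T])$: continuous $\varphi$ on $\mathcal G\times[0,T]$ whose restriction to each $J_i\times[0,T]$, as a function of $(\bar x,t)\in\mathbb R^+\times[0,T]$ via $\bar x\mapsto\bar xe_i$, is $C^1$. $D\varphi(x,t)=D\varphi_{|J_i}(x,t)\in\mathbb R$ (derivative in $\bar x$) for $x\in J_i\setminus\{O\}$, $D\varphi(O,t)=(D\varphi_{|J_1}(O,t),\dots,D\varphi_{|J_N}(O,t))\in\mathbb R^N$. Hamiltonians: $H_i(x,t,p)=\sup_{a\in\mathbb R}\{-pa-a^2/2-\ell_i(x,t)\}=p^2/2-\ell_i(x,t)$;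 $H_i^{\downarrow}(O,t,p)=\sup_{a\ge0}\{-pa-a^2/2-\ell_i(O,t)\}$; $H_O(t,(p_1,\dots,p_N))=\max\{-\ell_O(t),\max_iH_i^{\downarrow}(O,t,p_i)\}$. *)

theory Defs
  imports "HOL-Analysis.Analysis" "HOL-Probability.Probability"
begin

definition ray :: "(nat \<Rightarrow> 'a::euclidean_space) \<Rightarrow> nat \<Rightarrow> 'a set" where
  "ray e i = {s *\<^sub>R e i | s. s \<ge> 0}"

definition Gnet :: "nat \<Rightarrow> (nat \<Rightarrow> 'a::euclidean_space) \<Rightarrow> 'a set" where
  "Gnet N e = (\<Union>i\<in>{1..N}. ray e i)"

definition gdist :: "nat \<Rightarrow> (nat \<Rightarrow> 'a::euclidean_space) \<Rightarrow> 'a \<Rightarrow> 'a \<Rightarrow> real" where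
  "gdist N e x y = (if \<exists>i\<in>{1..N}. x \<in> ray e i \<and> y \<in> ray e i then dist x y else norm x + norm y)"

text \<open>Controls: elements of A are pairs (i, abar) with i in 0..N; dynamics f.\<close>

definition fdyn :: "(nat \<Rightarrow> 'a::euclidean_space) \<Rightarrow> nat \<times> real \<Rightarrow> 'a" where
  "fdyn e a = (if fst a = 0 then 0 else snd a *\<^sub>R e (fst a))"

text \<open>Gamma_t[x]: admissible trajectory/control pairs on [t,T] starting at x.
  W^{1,2} regularity of y is implied by the integral equation with an L^2 integrand.\<close>

definition Gamma :: "nat \<Rightarrow> (nat \<Rightarrow> 'a::euclidean_space) \<Rightarrow> real \<Rightarrow> real \<Rightarrow> 'a
     \<Rightarrow> ((real \<Rightarrow> 'a) \<times> (real \<Rightarrow> nat \<times> real)) set" where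
  "Gamma N e T t x = {(y, \<alpha>).
     \<alpha> \<in> borel_measurable (restrict_space lborel {t..T}) \<and>
     (AE \<tau> in lborel. \<tau> \<in> {t..T} \<longrightarrow>
        fst (\<alpha> \<tau>) \<le> N \<and> (y \<tau> \<noteq> 0 \<longrightarrow> fst (\<alpha> \<tau>) \<noteq> 0 \<and> y \<tau> \<in> ray e (fst (\<alpha> \<tau>)))) \<and>
     set_integrable lborel {t..T} (\<lambda>\<tau>. (snd (\<alpha> \<tau>))\<^sup>2) \<and>
     set_integrable lborel {t..T} (\<lambda>\<tau>. fdyn e (\<alpha> \<tau>)) \<and>
     (\<forall>s\<in>{t..T}. y s \<in> Gnet N e) \<and>
     (\<forall>s\<in>{t..T}. y s = x + (LINT \<tau>:{t..s}|lborel. fdyn e (\<alpha> \<tau>)))}"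

text \<open>The (unique) edge index of a point of the network different from O.\<close>
definition edge_idx :: "nat \<Rightarrow> (nat \<Rightarrow> 'a::euclidean_space) \<Rightarrow> 'a \<Rightarrow> nat" where
  "edge_idx N e x = The (\<lambda>i. i \<in> {1..N} \<and> x \<in> ray e i)"

definition Lnet :: "nat \<Rightarrow> (nat \<Rightarrow> 'a::euclidean_space) \<Rightarrow> (nat \<Rightarrow> 'm \<Rightarrow> 'a \<Rightarrow> real \<Rightarrow> real)
     \<Rightarrow> ('m \<Rightarrow> real \<Rightarrow> real) \<Rightarrow> 'm \<Rightarrow> 'a \<Rightarrow> real \<Rightarrow> real" where
  "Lnet N e Li Ls m x t = (if x = 0 then min (Ls m t) (Min ((\<lambda>i. Li i m 0 t) ` {1..N}))
                           else Li (edge_idx N e x) m x t)"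

definition gnet :: "nat \<Rightarrow> (nat \<Rightarrow> 'a::euclidean_space) \<Rightarrow> (nat \<Rightarrow> 'm \<Rightarrow> 'a \<Rightarrow> real)
     \<Rightarrow> ('m \<Rightarrow> real) \<Rightarrow> 'm \<Rightarrow> 'a \<Rightarrow> real" where
  "gnet N e Gi Gs m x = (if x = 0 then min (Gs m) (Min ((\<lambda>i. Gi i m 0) ` {1..N}))
                         else Gi (edge_idx N e x) m x)"

definition Jcost :: "real \<Rightarrow> real \<Rightarrow> ('a \<Rightarrow> real \<Rightarrow> real) \<Rightarrow> ('a \<Rightarrow> real)
     \<Rightarrow> (real \<Rightarrow> 'a) \<times> (real \<Rightarrow> nat \<times> real) \<Rightarrow> real" where
  "Jcost t T ell g p =
     (LINT \<tau>:{t..T}|lborel. ell (fst p \<tau>) \<tau> + (snd (snd p \<tau>))\<^sup>2 / 2) + g (fst p T)"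

definition value_fn :: "nat \<Rightarrow> (nat \<Rightarrow> 'a::euclidean_space) \<Rightarrow> real
     \<Rightarrow> ('a \<Rightarrow> real \<Rightarrow> real) \<Rightarrow> ('a \<Rightarrow> real) \<Rightarrow> 'a \<Rightarrow> real \<Rightarrow> real" where
  "value_fn N e T ell g x t =
     (if t < T then Inf (Jcost t T ell g ` Gamma N e T t x) else g x)"

definition msupp :: "'b::topological_space measure \<Rightarrow> 'b set" where
  "msupp M = {x. \<forall>U. open U \<and> x \<in> U \<longrightarrow> emeasure M U > 0}"

definition PG :: "nat \<Rightarrow> (nat \<Rightarrow> 'a::euclidean_space) \<Rightarrow> 'a measure \<Rightarrow> bool" where
  "PG N e m \<longleftrightarrow> prob_space m \<and> sets m = sets borel \<and> emeasure m (Gnet N e) = 1"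

text \<open>Narrow convergence of a sequence in P(G) (P(G) is metrizable, so
  sequential continuity is continuity).\<close>
definition narrow_conv :: "nat \<Rightarrow> (nat \<Rightarrow> 'a::euclidean_space) \<Rightarrow> (nat \<Rightarrow> 'a measure) \<Rightarrow> 'a measure \<Rightarrow> bool" where
  "narrow_conv N e ms m \<longleftrightarrow>
     (\<forall>f::'a \<Rightarrow> real. continuous_on (Gnet N e) f \<and> bounded (f ` Gnet N e) \<longrightarrow>
        (\<lambda>n. LINT x|ms n. f x) \<longlonglongrightarrow> (LINT x|m. f x))"

text \<open>Standing structural hypotheses on the costs: L_i : P(G) -> C(G x [0,T]),
  L_* : P(G) -> C([0,T]), G_i : P(G) -> C(G), G_* : P(G) -> R continuous (sup norms).\<close>
definition MFG_costs :: "nat \<Rightarrow> (nat \<Rightarrow> 'a::euclidean_space) \<Rightarrow> real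
     \<Rightarrow> (nat \<Rightarrow> 'a measure \<Rightarrow> 'a \<Rightarrow> real \<Rightarrow> real) \<Rightarrow> ('a measure \<Rightarrow> real \<Rightarrow> real)
     \<Rightarrow> (nat \<Rightarrow> 'a measure \<Rightarrow> 'a \<Rightarrow> real) \<Rightarrow> ('a measure \<Rightarrow> real) \<Rightarrow> bool" where
  "MFG_costs N e T Li Ls Gi Gs \<longleftrightarrow>
     (\<forall>m. PG N e m \<longrightarrow>
        (\<forall>i\<in>{1..N}. continuous_on (Gnet N e \<times> {0..T}) (\<lambda>(x,t). Li i m x t)
                   \<and> continuous_on (Gnet N e) (Gi i m))
        \<and> continuous_on {0..T} (Ls m)) \<and>
     (\<forall>ms m. (\<forall>n. PG N e (ms n)) \<longrightarrow> PG N e m \<longrightarrow> narrow_conv N e ms m \<longrightarrow>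
        (\<forall>i\<in>{1..N}.
           uniform_limit (Gnet N e \<times> {0..T}) (\<lambda>n (x,t). Li i (ms n) x t) (\<lambda>(x,t). Li i m x t) sequentially
         \<and> uniform_limit (Gnet N e) (\<lambda>n. Gi i (ms n)) (Gi i m) sequentially)
        \<and> uniform_limit {0..T} (\<lambda>n. Ls (ms n)) (Ls m) sequentially
        \<and> (\<lambda>n. Gs (ms n)) \<longlonglongrightarrow> Gs m)"

definition H_MFG1 :: "nat \<Rightarrow> (nat \<Rightarrow> 'a::euclidean_space) \<Rightarrow> real
     \<Rightarrow> (nat \<Rightarrow> 'a measure \<Rightarrow> 'a \<Rightarrow> real \<Rightarrow> real) \<Rightarrow> ('a measure \<Rightarrow> real \<Rightarrow> real)
     \<Rightarrow> (nat \<Rightarrow> 'a measure \<Rightarrow> 'a \<Rightarrow> real) \<Rightarrow> ('a measure \<Rightarrow> real) \<Rightarrow> bool" where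
  "H_MFG1 N e T Li Ls Gi Gs \<longleftrightarrow>
     (\<exists>K. \<forall>m. PG N e m \<longrightarrow>
        (\<forall>t\<in>{0..T}. \<bar>Ls m t\<bar> \<le> K) \<and> \<bar>Gs m\<bar> \<le> K \<and>
        (\<forall>i\<in>{1..N}. \<forall>x\<in>Gnet N e. \<bar>Gi i m x\<bar> \<le> K \<and> (\<forall>t\<in>{0..T}. \<bar>Li i m x t\<bar> \<le> K)))"

definition H_MFG2 :: "nat \<Rightarrow> (nat \<Rightarrow> 'a::euclidean_space) \<Rightarrow> 'a measure \<Rightarrow> bool" where
  "H_MFG2 N e m0 \<longleftrightarrow> PG N e m0 \<and> compact (msupp m0)"

text \<open>Paths on [0,T] are represented as bounded continuous functions on R that are
  constant on (-inf,0] and on [T,inf); the sup metric of this type is then the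
  uniform metric on [0,T].  W12 T y v: y is W^{1,2} on [0,T] with weak derivative v.\<close>
definition W12 :: "real \<Rightarrow> (real \<Rightarrow> 'a::euclidean_space) \<Rightarrow> (real \<Rightarrow> 'a) \<Rightarrow> bool" where
  "W12 T y v \<longleftrightarrow> v \<in> borel_measurable lborel \<and>
     set_integrable lborel {0..T} v \<and>
     set_integrable lborel {0..T} (\<lambda>\<tau>. (norm (v \<tau>))\<^sup>2) \<and>
     (\<forall>s\<in>{0..T}. y s = y 0 + (LINT \<tau>:{0..s}|lborel. v \<tau>))"

definition Ftil :: "nat \<Rightarrow> (nat \<Rightarrow> 'a::euclidean_space) \<Rightarrow> 'a \<Rightarrow> 'a \<Rightarrow> bool" where
  "Ftil N e x v \<longleftrightarrow>
     (if x = 0 then (\<exists>i\<in>{1..N}. \<exists>r. v = r *\<^sub>R e i)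
      else (\<forall>i\<in>{1..N}. x \<in> ray e i \<longrightarrow> (\<exists>r. v = r *\<^sub>R e i)))"

definition GammaT :: "nat \<Rightarrow> (nat \<Rightarrow> 'a::euclidean_space) \<Rightarrow> real \<Rightarrow> real \<Rightarrow> 'a
     \<Rightarrow> (real \<Rightarrow>\<^sub>C 'a) set" where
  "GammaT N e T C x = {y :: real \<Rightarrow>\<^sub>C 'a.
     (\<forall>s\<le>0. apply_bcontfun y s = apply_bcontfun y 0) \<and> (\<forall>s\<ge>T. apply_bcontfun y s = apply_bcontfun y T) \<and> apply_bcontfun y 0 = x \<and>
     (\<forall>s\<in>{0..T}. apply_bcontfun y s \<in> Gnet N e \<and> gdist N e (apply_bcontfun y s) 0 \<le> C) \<and>
     (\<exists>v. W12 T (apply_bcontfun y) v \<and>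
          (AE \<tau> in lborel. \<tau> \<in> {0..T} \<longrightarrow> Ftil N e (apply_bcontfun y \<tau>) (v \<tau>)) \<and>
          sqrt (LINT \<tau>:{0..T}|lborel. (norm (v \<tau>))\<^sup>2) \<le> C)}"

definition GammaT_all :: "nat \<Rightarrow> (nat \<Rightarrow> 'a::euclidean_space) \<Rightarrow> real \<Rightarrow> real \<Rightarrow> (real \<Rightarrow>\<^sub>C 'a) set" where
  "GammaT_all N e T C = (\<Union>x. GammaT N e T C x)"

definition PGamma :: "nat \<Rightarrow> (nat \<Rightarrow> 'a::euclidean_space) \<Rightarrow> real \<Rightarrow> real \<Rightarrow> (real \<Rightarrow>\<^sub>C 'a) measure \<Rightarrow> bool" where
  "PGamma N e T C \<mu> \<longleftrightarrow> prob_space \<mu> \<and> sets \<mu> = sets borel \<and> emeasure \<mu> (GammaT_all N e T C) = 1"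

definition mmu :: "(real \<Rightarrow>\<^sub>C 'a::euclidean_space) measure \<Rightarrow> real \<Rightarrow> 'a measure" where
  "mmu \<mu> t = distr \<mu> borel (\<lambda>y. apply_bcontfun y t)"

definition Jmu :: "nat \<Rightarrow> (nat \<Rightarrow> 'a::euclidean_space) \<Rightarrow> real
     \<Rightarrow> (nat \<Rightarrow> 'a measure \<Rightarrow> 'a \<Rightarrow> real \<Rightarrow> real) \<Rightarrow> ('a measure \<Rightarrow> real \<Rightarrow> real)
     \<Rightarrow> (nat \<Rightarrow> 'a measure \<Rightarrow> 'a \<Rightarrow> real) \<Rightarrow> ('a measure \<Rightarrow> real)
     \<Rightarrow> (real \<Rightarrow>\<^sub>C 'a) measure \<Rightarrow> (real \<Rightarrow> 'a) \<times> (real \<Rightarrow> nat \<times> real) \<Rightarrow> real" where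
  "Jmu N e T Li Ls Gi Gs \<mu> p =
     Jcost 0 T (\<lambda>x \<tau>. Lnet N e Li Ls (mmu \<mu> \<tau>) x \<tau>) (gnet N e Gi Gs (mmu \<mu> T)) p"

definition opt_paths :: "nat \<Rightarrow> (nat \<Rightarrow> 'a::euclidean_space) \<Rightarrow> real
     \<Rightarrow> (nat \<Rightarrow> 'a measure \<Rightarrow> 'a \<Rightarrow> real \<Rightarrow> real) \<Rightarrow> ('a measure \<Rightarrow> real \<Rightarrow> real)
     \<Rightarrow> (nat \<Rightarrow> 'a measure \<Rightarrow> 'a \<Rightarrow> real) \<Rightarrow> ('a measure \<Rightarrow> real)
     \<Rightarrow> real \<Rightarrow> (real \<Rightarrow>\<^sub>C 'a) measure \<Rightarrow> 'a \<Rightarrow> (real \<Rightarrow>\<^sub>C 'a) set" where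
  "opt_paths N e T Li Ls Gi Gs C \<mu> x = {y \<in> GammaT N e T C x.
     \<exists>\<alpha>. (apply_bcontfun y, \<alpha>) \<in> Gamma N e T 0 x \<and>
         (AE \<tau> in lborel. \<tau> \<in> {0..T} \<longrightarrow> apply_bcontfun y \<tau> = 0 \<longrightarrow> \<alpha> \<tau> = (0, 0)) \<and>
         (\<forall>p\<in>Gamma N e T 0 x. Jmu N e T Li Ls Gi Gs \<mu> (apply_bcontfun y, \<alpha>) \<le> Jmu N e T Li Ls Gi Gs \<mu> p)}"

definition MFG_equilibrium :: "nat \<Rightarrow> (nat \<Rightarrow> 'a::euclidean_space) \<Rightarrow> real
     \<Rightarrow> (nat \<Rightarrow> 'a measure \<Rightarrow> 'a \<Rightarrow> real \<Rightarrow> real) \<Rightarrow> ('a measure \<Rightarrow> real \<Rightarrow> real)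
     \<Rightarrow> (nat \<Rightarrow> 'a measure \<Rightarrow> 'a \<Rightarrow> real) \<Rightarrow> ('a measure \<Rightarrow> real)
     \<Rightarrow> 'a measure \<Rightarrow> real \<Rightarrow> (real \<Rightarrow>\<^sub>C 'a) measure \<Rightarrow> bool" where
  "MFG_equilibrium N e T Li Ls Gi Gs m0 C \<mu> \<longleftrightarrow>
     PGamma N e T C \<mu> \<and> distr \<mu> borel (\<lambda>y. apply_bcontfun y 0) = m0 \<and>
     msupp \<mu> \<subseteq> (\<Union>x\<in>msupp m0. opt_paths N e T Li Ls Gi Gs C \<mu> x)"

definition Ctilde_prop :: "nat \<Rightarrow> (nat \<Rightarrow> 'a::euclidean_space) \<Rightarrow> real
     \<Rightarrow> (nat \<Rightarrow> 'a measure \<Rightarrow> 'a \<Rightarrow> real \<Rightarrow> real) \<Rightarrow> ('a measure \<Rightarrow> real \<Rightarrow> real)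
     \<Rightarrow> (nat \<Rightarrow> 'a measure \<Rightarrow> 'a \<Rightarrow> real) \<Rightarrow> ('a measure \<Rightarrow> real)
     \<Rightarrow> 'a measure \<Rightarrow> real \<Rightarrow> bool" where
  "Ctilde_prop N e T Li Ls Gi Gs m0 Ct \<longleftrightarrow> Ct > 0 \<and>
     (\<forall>C>0. \<forall>\<mu>. PGamma N e T C \<mu> \<longrightarrow> (\<forall>x\<in>msupp m0. \<forall>(y, \<alpha>)\<in>Gamma N e T 0 x.
        (\<forall>p\<in>Gamma N e T 0 x. Jmu N e T Li Ls Gi Gs \<mu> (y, \<alpha>) \<le> Jmu N e T Li Ls Gi Gs \<mu> p) \<longrightarrow>
          sqrt (LINT \<tau>:{0..T}|lborel. (snd (\<alpha> \<tau>))\<^sup>2) \<le> Ct \<and>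
          (\<exists>z\<in>GammaT N e T Ct x. \<forall>s\<in>{0..T}. apply_bcontfun z s = y s)))"

definition C1_net :: "nat \<Rightarrow> (nat \<Rightarrow> 'a::euclidean_space) \<Rightarrow> real \<Rightarrow> ('a \<Rightarrow> real \<Rightarrow> real)
     \<Rightarrow> (nat \<Rightarrow> real \<times> real \<Rightarrow> real) \<Rightarrow> (nat \<Rightarrow> real \<times> real \<Rightarrow> real) \<Rightarrow> bool" where
  "C1_net N e T \<phi> Dx Dt \<longleftrightarrow>
     continuous_on (Gnet N e \<times> {0..T}) (\<lambda>(x,t). \<phi> x t) \<and>
     (\<forall>i\<in>{1..N}. continuous_on ({0..} \<times> {0..T}) (Dx i) \<and> continuous_on ({0..} \<times> {0..T}) (Dt i) \<and>
        (\<forall>p\<in>{0..} \<times> {0..T}.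
           ((\<lambda>(r,s). \<phi> (r *\<^sub>R e i) s) has_derivative (\<lambda>(h,k). Dx i p * h + Dt i p * k))
             (at p within {0..} \<times> {0..T})))"

definition loc_max_net :: "nat \<Rightarrow> (nat \<Rightarrow> 'a::euclidean_space) \<Rightarrow> real \<Rightarrow> ('a \<Rightarrow> real \<Rightarrow> real) \<Rightarrow> 'a \<Rightarrow> real \<Rightarrow> bool" where
  "loc_max_net N e T w x t \<longleftrightarrow> (\<exists>\<epsilon>>0. \<forall>y\<in>Gnet N e. \<forall>s\<in>{0..T}.
     gdist N e y x < \<epsilon> \<and> \<bar>s - t\<bar> < \<epsilon> \<longrightarrow> w y s \<le> w x t)"

definition loc_min_net :: "nat \<Rightarrow> (nat \<Rightarrow> 'a::euclidean_space) \<Rightarrow> real \<Rightarrow> ('a \<Rightarrow> real \<Rightarrow> real) \<Rightarrow> 'a \<Rightarrow> real \<Rightarrow> bool" where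
  "loc_min_net N e T w x t \<longleftrightarrow> (\<exists>\<epsilon>>0. \<forall>y\<in>Gnet N e. \<forall>s\<in>{0..T}.
     gdist N e y x < \<epsilon> \<and> \<bar>s - t\<bar> < \<epsilon> \<longrightarrow> w y s \<ge> w x t)"

definition Hedge :: "real \<Rightarrow> real \<Rightarrow> real" where
  "Hedge l p = p\<^sup>2 / 2 - l"

definition Hdown :: "real \<Rightarrow> real \<Rightarrow> real" where
  "Hdown l p = Sup ((\<lambda>a. - p * a - a\<^sup>2 / 2 - l) ` {0..})"

definition HO :: "nat \<Rightarrow> real \<Rightarrow> (nat \<Rightarrow> real) \<Rightarrow> (nat \<Rightarrow> real) \<Rightarrow> real" where
  "HO N lO lOi p = max (- lO) (Max ((\<lambda>i. Hdown (lOi i) (p i)) ` {1..N}))"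

end

(*
  The flow t |-> m^mu(t) is narrowly continuous, so along it the running costs are jointly
  continuous in space and time and the claim becomes one about a deterministic control problem
  on the network; of the equilibrium only mu in P(Gamma_C) matters.

  By dynamic programming, testing a local maximum of u - phi with constant controls gives the
  subsolution property.  At a local minimum one follows a path that is optimal up to o(h) on
  [t, t+h].  Only its end point is compared with phi, so no chain rule along Sobolev paths is
  needed: Young's inequality bounds the displacement by the energy.
*)
theory Submission
  imports Defs
begin

text \<open>The obstacle is the vertex: the running cost may jump there, from the edge costs down to
  \<open>ellO\<close>, and a near-optimal path may change edges infinitely often in a short time.
  Two one-sided facts replace continuity. Along an edge, vertex included, the cost is at most the
  edge cost; this serves the upper bounds. Near the vertex it is at least
  \<open>ellO t - \<epsilon>\<close> on every edge, because \<open>ellO\<close> lies below all edge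
  costs; this serves the lower bounds. In the supersolution part the slope \<open>a\<close> in
  Young's inequality, displacement times \<open>a\<close> at most energy plus
  \<open>h * a^2 / 2\<close>, is free. It is taken as the maximizing speed of the Hamiltonian
  enlarged by \<open>\<epsilon>\<close>, so that \<open>a^2 / 2\<close> reproduces the quadratic
  part of the Hamiltonian. The enlargement pays for the remainder of the first-order expansion,
  which is \<open>\<epsilon>\<close> times a displacement not known to be of order \<open>h\<close>.
  Seen from the vertex every displacement points outward, so the signed derivative enters and
  \<open>a\<close> is cut off at \<open>0\<close>; this produces \<open>Hdown\<close>.\<close>

section \<open>Set integrals over compact intervals\<close>

lemma set_lebesgue_integral_combine:
  fixes f :: "real \<Rightarrow> 'b::euclidean_space"
  assumes "a \<le> c" "c \<le> b" "set_integrable lborel {a..b} f"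
  shows "(LINT x:{a..c}|lborel. f x) + (LINT x:{c..b}|lborel. f x) = (LINT x:{a..b}|lborel. f x)"
proof -
  have sub: "set_integrable lborel {a..c} f" "set_integrable lborel {c..b} f"
    using assms by (auto intro: set_integrable_subset)
  show ?thesis
    using Henstock_Kurzweil_Integration.integral_combine
        [OF assms(1,2) set_borel_integral_eq_integral(1)[OF assms(3)]]
    by (simp add: sub assms set_borel_integral_eq_integral(2))
qed

text \<open>The right end point is a null set. Concatenated controls switch exactly there.\<close>

lemma set_lebesgue_integral_cong_Ico:
  fixes f h :: "real \<Rightarrow> 'b::euclidean_space"
  assumes "set_integrable lborel {a..b} f" "set_integrable lborel {a..b} h"
    and "\<And>x. x \<in> {a..<b} \<Longrightarrow> f x = h x"
  shows "(LINT x:{a..b}|lborel. f x) = (LINT x:{a..b}|lborel. h x)"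
  using integral_spike[OF negligible_sing[of b], of "{a..b}" h f] assms
  by (simp add: set_borel_integral_eq_integral(2))

lemma set_integrable_const_Icc:
  fixes c :: "'b::euclidean_space"
  shows "set_integrable lborel {a..b::real} (\<lambda>_. c)"
  unfolding set_integrable_def by (intro integrable_scaleR_left integrable_real_indicator)
    (auto simp: emeasure_lborel_Icc_eq)

lemma set_lebesgue_integral_const_Icc:
  fixes c :: "'b::euclidean_space"
  assumes "a \<le> b"
  shows "(LINT x:{a..b::real}|lborel. c) = (b - a) *\<^sub>R c"
  using assms set_borel_integral_eq_integral(2)[OF set_integrable_const_Icc[of a b c]]
  by simp

section \<open>Networks and admissible controls\<close>

locale network =
  fixes N :: nat and e :: "nat \<Rightarrow> 'a::euclidean_space"
  assumes N_pos: "N \<ge> 1"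
    and norm_e: "\<And>i. i \<in> {1..N} \<Longrightarrow> norm (e i) = 1"
    and inj_e: "inj_on e {1..N}"
begin

text \<open>As \<open>e i\<close> is a unit vector, the norm is the coordinate along the edge. A ray
  thus becomes the set where two continuous maps agree, and all later expansions use
  \<open>norm x\<close> as edge coordinate.\<close>

lemma ray_iff:
  assumes "i \<in> {1..N}"
  shows "x \<in> ray e i \<longleftrightarrow> x = norm x *\<^sub>R e i"
proof
  assume "x \<in> ray e i"
  then show "x = norm x *\<^sub>R e i"
    using norm_e[OF assms] by (auto simp: ray_def)
qed (auto simp: ray_def intro!: exI[of _ "norm x"])

lemma scaleR_mem_ray: "r \<ge> 0 \<Longrightarrow> r *\<^sub>R e i \<in> ray e i"
  by (auto simp: ray_def)

lemma zero_mem_ray [simp]: "0 \<in> ray e i"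
  using scaleR_mem_ray[of 0 i] by simp

lemma ray_unique:
  assumes "i \<in> {1..N}" "j \<in> {1..N}" "x \<in> ray e i" "x \<in> ray e j" "x \<noteq> 0"
  shows "i = j"
proof -
  have "norm x *\<^sub>R e i = norm x *\<^sub>R e j"
    using assms ray_iff by metis
  then have "e i = e j"
    using assms(5) by simp
  then show ?thesis
    using inj_e assms(1,2) by (auto dest: inj_onD)
qed

lemma edge_idx_eq:
  assumes "i \<in> {1..N}" "x \<in> ray e i" "x \<noteq> 0"
  shows "edge_idx N e x = i"
  unfolding edge_idx_def using assms ray_unique by (intro the_equality) blast+

lemma closed_ray: "i \<in> {1..N} \<Longrightarrow> closed (ray e i)"
proof -
  assume i: "i \<in> {1..N}"
  have "ray e i = {x. x = norm x *\<^sub>R e i}"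
    using ray_iff[OF i] by blast
  then show ?thesis
    by (simp add: closed_Collect_eq continuous_intros)
qed

lemma ray_subset_Gnet: "i \<in> {1..N} \<Longrightarrow> ray e i \<subseteq> Gnet N e"
  by (auto simp: Gnet_def)

lemma closed_Gnet: "closed (Gnet N e)"
  unfolding Gnet_def by (intro closed_UN) (auto intro: closed_ray)

lemma zero_mem_Gnet: "0 \<in> Gnet N e"
  using ray_subset_Gnet[of 1] N_pos by force

lemma gdist_same_ray:
  "i \<in> {1..N} \<Longrightarrow> x \<in> ray e i \<Longrightarrow> y \<in> ray e i \<Longrightarrow> gdist N e x y = dist x y"
  by (auto simp: gdist_def)

lemma gdist_zero: "gdist N e x 0 = norm x"
  by (auto simp: gdist_def)

text \<open>Away from the vertex the edges are disjoint and relatively closed, so a connected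
  piece of a path that avoids the vertex stays on one edge.\<close>

lemma path_stays_on_ray:
  assumes S: "connected S" and y: "continuous_on S y" "\<And>s. s \<in> S \<Longrightarrow> y s \<in> Gnet N e - {0}"
    and j: "j \<in> {1..N}" and s0: "s0 \<in> S" "y s0 \<in> ray e j" and s: "s \<in> S"
  shows "y s \<in> ray e j"
proof (rule ccontr)
  assume n: "y s \<notin> ray e j"
  let ?B = "\<Union>i\<in>{1..N} - {j}. ray e i"
  have "connected (y ` S)"
    by (rule connected_continuous_image[OF y(1) S])
  moreover have "closed (ray e j)" "closed ?B"
    using j by (auto intro!: closed_ray closed_UN)
  moreover have "y ` S \<subseteq> ray e j \<union> ?B"
    using y(2) by (fastforce simp: Gnet_def)
  moreover have "ray e j \<inter> ?B \<inter> y ` S = {}"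
    using y(2) ray_unique j by fastforce
  moreover have "ray e j \<inter> y ` S \<noteq> {}"
    using s0 by auto
  moreover have "?B \<inter> y ` S \<noteq> {}"
    using s n y(2)[OF s] by (fastforce simp: Gnet_def)
  ultimately show False
    unfolding connected_closed by blast
qed

section \<open>Restricting, joining and constructing admissible pairs\<close>

lemma GammaD:
  assumes "(y, \<alpha>) \<in> Gamma N e S t x"
  shows "\<alpha> \<in> borel_measurable (restrict_space lborel {t..S})"
    and "AE \<tau> in lborel. \<tau> \<in> {t..S} \<longrightarrow> fst (\<alpha> \<tau>) \<le> N \<and>
      (y \<tau> \<noteq> 0 \<longrightarrow> fst (\<alpha> \<tau>) \<noteq> 0 \<and> y \<tau> \<in> ray e (fst (\<alpha> \<tau>)))"
    and "set_integrable lborel {t..S} (\<lambda>\<tau>. (snd (\<alpha> \<tau>))\<^sup>2)"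
    and "set_integrable lborel {t..S} (\<lambda>\<tau>. fdyn e (\<alpha> \<tau>))"
    and "\<And>s. s \<in> {t..S} \<Longrightarrow> y s \<in> Gnet N e"
    and "\<And>s. s \<in> {t..S} \<Longrightarrow> y s = x + (LINT \<tau>:{t..s}|lborel. fdyn e (\<alpha> \<tau>))"
  using assms by (auto simp: Gamma_def)

lemma Gamma_initial:
  assumes "(y, \<alpha>) \<in> Gamma N e S t x" "t \<le> S"
  shows "y t = x"
proof -
  have "set_integrable lborel {t..t} (\<lambda>\<tau>. fdyn e (\<alpha> \<tau>))"
    using assms by (intro set_integrable_subset[OF GammaD(4)[OF assms(1)]]) auto
  then show ?thesis
    using GammaD(6)[OF assms(1), of t] assms(2) by (simp add: set_borel_integral_eq_integral(2))
qed

lemma Gamma_diff: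
  assumes G: "(y, \<alpha>) \<in> Gamma N e S t x" and "t \<le> a" "a \<le> b" "b \<le> S"
  shows "y b = y a + (LINT \<tau>:{a..b}|lborel. fdyn e (\<alpha> \<tau>))"
proof -
  have "set_integrable lborel {t..b} (\<lambda>\<tau>. fdyn e (\<alpha> \<tau>))"
    using assms by (intro set_integrable_subset[OF GammaD(4)[OF G]]) auto
  then show ?thesis
    using GammaD(6)[OF G, of a] GammaD(6)[OF G, of b] assms(2-)
      set_lebesgue_integral_combine[of t a b "\<lambda>\<tau>. fdyn e (\<alpha> \<tau>)"]
    by auto
qed

lemma Gamma_continuous:
  assumes G: "(y, \<alpha>) \<in> Gamma N e S t x"
  shows "continuous_on {t..S} y"
proof -
  let ?f = "\<lambda>\<tau>. fdyn e (\<alpha> \<tau>)"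
  have "continuous_on {t..S} (\<lambda>s. x + integral {t..s} ?f)"
    by (intro continuous_intros indefinite_integral_continuous_1 
        set_borel_integral_eq_integral(1) GammaD(4)[OF G])
  moreover have "x + integral {t..s} ?f = y s" if "s \<in> {t..S}" for s
  proof -
    have "set_integrable lborel {t..s} ?f"
      using that by (intro set_integrable_subset[OF GammaD(4)[OF G]]) auto
    then show ?thesis
      using GammaD(6)[OF G that] by (simp add: set_borel_integral_eq_integral(2))
  qed
  ultimately show ?thesis
    by (rule continuous_on_eq)
qed

text \<open>Young's inequality in place of Cauchy--Schwarz: optimising over the free
  parameter \<open>a\<close> would give the usual bound.\<close>

lemma Gamma_displacement:
  assumes G: "(y, \<alpha>) \<in> Gamma N e S t x" and le: "t \<le> \<sigma>" "\<sigma> \<le> s" "s \<le> S" and a: "a \<ge> 0"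
  shows "a * norm (y s - y \<sigma>) \<le> (LINT \<tau>:{\<sigma>..s}|lborel. (snd (\<alpha> \<tau>))\<^sup>2 / 2) + (s - \<sigma>) * (a\<^sup>2 / 2)"
proof -
  let ?f = "\<lambda>\<tau>. fdyn e (\<alpha> \<tau>)"
  have sub: "{\<sigma>..s} \<subseteq> {t..S}"
    using le by auto
  have f: "set_integrable lborel {\<sigma>..s} ?f"
    using sub by (intro set_integrable_subset[OF GammaD(4)[OF G]]) auto
  have q: "set_integrable lborel {\<sigma>..s} (\<lambda>\<tau>. (snd (\<alpha> \<tau>))\<^sup>2 / 2)"
    using sub by (intro set_integrable_divide set_integrable_subset[OF GammaD(3)[OF G]]) auto
  have "norm (y s - y \<sigma>) \<le> (LINT \<tau>:{\<sigma>..s}|lborel. norm (?f \<tau>))"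
    using Gamma_diff[OF G le] set_integral_norm_bound[OF f] by simp
  then have "a * norm (y s - y \<sigma>) \<le> a * (LINT \<tau>:{\<sigma>..s}|lborel. norm (?f \<tau>))"
    using a by (rule mult_left_mono)
  also have "\<dots> = (LINT \<tau>:{\<sigma>..s}|lborel. a * norm (?f \<tau>))"
    by simp
  also have "\<dots> \<le> (LINT \<tau>:{\<sigma>..s}|lborel. (snd (\<alpha> \<tau>))\<^sup>2 / 2 + a\<^sup>2 / 2)"
  proof (rule set_integral_mono_AE)
    show "set_integrable lborel {\<sigma>..s} (\<lambda>\<tau>. a * norm (?f \<tau>))"
      using set_integrable_norm[OF f] by (intro set_integrable_mult_right)
    show "set_integrable lborel {\<sigma>..s} (\<lambda>\<tau>. (snd (\<alpha> \<tau>))\<^sup>2 / 2 + a\<^sup>2 / 2)"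
      by (intro set_integral_add q set_integrable_const_Icc)
    show "AE \<tau>\<in>{\<sigma>..s} in lborel. a * norm (?f \<tau>) \<le> (snd (\<alpha> \<tau>))\<^sup>2 / 2 + a\<^sup>2 / 2"
      using GammaD(2)[OF G]
    proof eventually_elim
      case (elim \<tau>)
      show ?case
      proof
        assume "\<tau> \<in> {\<sigma>..s}"
        then have "fst (\<alpha> \<tau>) \<le> N"
          using elim sub by auto
        then have "norm (?f \<tau>) \<le> \<bar>snd (\<alpha> \<tau>)\<bar>"
          using norm_e[of "fst (\<alpha> \<tau>)"] by (auto simp: fdyn_def)
        then have "a * norm (?f \<tau>) \<le> a * \<bar>snd (\<alpha> \<tau>)\<bar>"
          using a by (rule mult_left_mono)
        also have "\<dots> \<le> (snd (\<alpha> \<tau>))\<^sup>2 / 2 + a\<^sup>2 / 2"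
          using sum_squares_bound[of a "\<bar>snd (\<alpha> \<tau>)\<bar>"] by simp
        finally show "a * norm (?f \<tau>) \<le> (snd (\<alpha> \<tau>))\<^sup>2 / 2 + a\<^sup>2 / 2" .
      qed
    qed
  qed
  also have "\<dots> = (LINT \<tau>:{\<sigma>..s}|lborel. (snd (\<alpha> \<tau>))\<^sup>2 / 2) + (s - \<sigma>) * (a\<^sup>2 / 2)"
    using le set_lebesgue_integral_const_Icc[of \<sigma> s "a\<^sup>2 / 2"]
    by (simp only: set_integral_add(2)[OF q set_integrable_const_Icc] real_scaleR_def)
  finally show ?thesis .
qed

lemma Gamma_tail:
  assumes G: "(y, \<alpha>) \<in> Gamma N e S t x" and le: "t \<le> s" "s \<le> S"
  shows "(y, \<alpha>) \<in> Gamma N e S s (y s)"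
proof -
  have sub: "{s..S} \<subseteq> {t..S}"
    using le by auto
  have "AE \<tau> in lborel. \<tau> \<in> {s..S} \<longrightarrow> fst (\<alpha> \<tau>) \<le> N \<and>
      (y \<tau> \<noteq> 0 \<longrightarrow> fst (\<alpha> \<tau>) \<noteq> 0 \<and> y \<tau> \<in> ray e (fst (\<alpha> \<tau>)))"
    using GammaD(2)[OF G] by eventually_elim (use sub in auto)
  moreover have "y r \<in> Gnet N e" if "r \<in> {s..S}" for r
    using GammaD(5)[OF G, of r] that sub by blast
  moreover have "y r = y s + (LINT \<tau>:{s..r}|lborel. fdyn e (\<alpha> \<tau>))" if "r \<in> {s..S}" for r
    using Gamma_diff[OF G le(1), of r] that by simp
  moreover have "set_integrable lborel {s..S} (\<lambda>\<tau>. (snd (\<alpha> \<tau>))\<^sup>2)"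
    "set_integrable lborel {s..S} (\<lambda>\<tau>. fdyn e (\<alpha> \<tau>))"
    using set_integrable_subset[OF GammaD(3)[OF G] _ sub] set_integrable_subset[OF GammaD(4)[OF G] _ sub]
    by simp_all
  ultimately show ?thesis
    using measurable_restrict_mono[OF GammaD(1)[OF G] sub]
    unfolding Gamma_def by blast
qed

text \<open>The second piece starts at \<open>y1 s\<close>, so the integral equations fit together
  at \<open>s\<close>.\<close>

lemma Gamma_concat:
  assumes G1: "(y1, \<alpha>1) \<in> Gamma N e s t x" and G2: "(y2, \<alpha>2) \<in> Gamma N e S s (y1 s)"
    and le: "t \<le> s" "s \<le> S"
  shows "(\<lambda>\<tau>. if \<tau> < s then y1 \<tau> else y2 \<tau>, \<lambda>\<tau>. if \<tau> < s then \<alpha>1 \<tau> else \<alpha>2 \<tau>) \<in> Gamma N e S t x"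
    (is "(?y, ?\<alpha>) \<in> _")
proof -
  \<comment> \<open>Kept general in \<open>h\<close> because it is used for both the velocity and
    the energy.\<close>
  have int: "set_integrable lborel {t..S} (\<lambda>\<tau>. h (?\<alpha> \<tau>))"
    if h1: "set_integrable lborel {t..s} (\<lambda>\<tau>. h (\<alpha>1 \<tau>))"
      and h2: "set_integrable lborel {s..S} (\<lambda>\<tau>. h (\<alpha>2 \<tau>))" for h :: "_ \<Rightarrow> 'c::euclidean_space"
  proof -
    have "set_integrable lborel ({t..<s} \<union> {s..S}) (\<lambda>\<tau>. h (?\<alpha> \<tau>))"
    proof (rule set_integrable_Un)
      have "set_integrable lborel {t..<s} (\<lambda>\<tau>. h (\<alpha>1 \<tau>))"
        by (rule set_integrable_subset[OF h1]) auto
      then show "set_integrable lborel {t..<s} (\<lambda>\<tau>. h (?\<alpha> \<tau>))"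
        by (subst set_integrable_cong[OF refl refl, of _ _ "\<lambda>\<tau>. h (\<alpha>1 \<tau>)"]) auto
      show "set_integrable lborel {s..S} (\<lambda>\<tau>. h (?\<alpha> \<tau>))"
        using h2 by (subst set_integrable_cong[OF refl refl, of _ _ "\<lambda>\<tau>. h (\<alpha>2 \<tau>)"]) auto
    qed auto
    moreover have "{t..<s} \<union> {s..S} = {t..S}"
      using le by auto
    ultimately show ?thesis
      by simp
  qed
  have f: "set_integrable lborel {t..S} (\<lambda>\<tau>. fdyn e (?\<alpha> \<tau>))"
    by (rule int) (use GammaD(4)[OF G1] GammaD(4)[OF G2] in auto)
  have mem: "?y \<tau> \<in> Gnet N e" if "\<tau> \<in> {t..S}" for \<tau>
    using that GammaD(5)[OF G1, of \<tau>] GammaD(5)[OF G2, of \<tau>] by auto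
  have "AE \<tau> in lborel. \<tau> \<in> {t..S} \<longrightarrow> fst (?\<alpha> \<tau>) \<le> N \<and>
      (?y \<tau> \<noteq> 0 \<longrightarrow> fst (?\<alpha> \<tau>) \<noteq> 0 \<and> ?y \<tau> \<in> ray e (fst (?\<alpha> \<tau>)))"
    using GammaD(2)[OF G1] GammaD(2)[OF G2] by eventually_elim auto
  moreover have "?\<alpha> \<in> borel_measurable (restrict_space lborel {t..S})"
  proof (subst measurable_If_restrict_space_iff)
    have "\<alpha>1 \<in> borel_measurable (restrict_space lborel ({t..S} \<inter> {\<tau>. \<tau> < s}))"
      by (rule measurable_restrict_mono[OF GammaD(1)[OF G1]]) auto
    moreover have "\<alpha>2 \<in> borel_measurable (restrict_space lborel ({t..S} \<inter> {\<tau>. \<not> \<tau> < s}))"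
      by (rule measurable_restrict_mono[OF GammaD(1)[OF G2]]) auto
    ultimately show "\<alpha>1 \<in> borel_measurable (restrict_space (restrict_space lborel {t..S}) {\<tau>. \<tau> < s}) \<and>
        \<alpha>2 \<in> borel_measurable (restrict_space (restrict_space lborel {t..S}) {\<tau>. \<not> \<tau> < s})"
      by (simp add: restrict_restrict_space not_less)
  qed (auto simp: sets_restrict_space space_restrict_space image_iff intro!: bexI[of _ "{..<s}"])
  moreover have "?y r = x + (LINT \<tau>:{t..r}|lborel. fdyn e (?\<alpha> \<tau>))" if r: "r \<in> {t..S}" for r
  proof -
    \<comment> \<open>For \<open>r = s\<close> the two controls may differ, but only at the end
      point.\<close>
    have first: "(LINT \<tau>:{t..r}|lborel. fdyn e (?\<alpha> \<tau>)) = (LINT \<tau>:{t..r}|lborel. fdyn e (\<alpha>1 \<tau>))"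
      if "r \<le> s" for r
      using that le r
      by (intro set_lebesgue_integral_cong_Ico set_integrable_subset[OF f]
          set_integrable_subset[OF GammaD(4)[OF G1]]) auto
    show ?thesis
    proof (cases "r < s")
      case True
      then show ?thesis
        using GammaD(6)[OF G1, of r] first[of r] r by auto
    next
      case False
      have "(LINT \<tau>:{t..r}|lborel. fdyn e (?\<alpha> \<tau>)) =
          (LINT \<tau>:{t..s}|lborel. fdyn e (?\<alpha> \<tau>)) + (LINT \<tau>:{s..r}|lborel. fdyn e (?\<alpha> \<tau>))"
        using False r le
        by (intro set_lebesgue_integral_combine[symmetric] set_integrable_subset[OF f]) auto
      also have "(LINT \<tau>:{s..r}|lborel. fdyn e (?\<alpha> \<tau>)) = (LINT \<tau>:{s..r}|lborel. fdyn e (\<alpha>2 \<tau>))"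
        by (rule set_lebesgue_integral_cong) auto
      finally show ?thesis
        using False r first[of s] le GammaD(6)[OF G1, of s] GammaD(6)[OF G2, of r] by auto
    qed
  qed
  moreover have "set_integrable lborel {t..S} (\<lambda>\<tau>. (snd (?\<alpha> \<tau>))\<^sup>2)"
    by (rule int) (use GammaD(3)[OF G1] GammaD(3)[OF G2] in auto)
  ultimately show ?thesis
    using f mem unfolding Gamma_def by simp
qed

lemma Gamma_const:
  assumes "t \<le> S" "i \<le> N"
    and y: "\<And>\<tau>. \<tau> \<in> {t..S} \<Longrightarrow> y \<tau> = x + (\<tau> - t) *\<^sub>R fdyn e (i, a)"
    and ray: "\<And>\<tau>. \<tau> \<in> {t..S} \<Longrightarrow> y \<tau> \<noteq> 0 \<Longrightarrow> i \<noteq> 0 \<and> y \<tau> \<in> ray e i"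
  shows "(y, \<lambda>_. (i, a)) \<in> Gamma N e S t x"
proof -
  have "y \<tau> \<in> Gnet N e" if "\<tau> \<in> {t..S}" for \<tau>
  proof (cases "y \<tau> = 0")
    case False
    then show ?thesis
      using ray[OF that] ray_subset_Gnet[of i] assms(2) by auto
  qed (use zero_mem_Gnet in simp)
  then show ?thesis
    using assms set_lebesgue_integral_const_Icc[of t _ "fdyn e (i, a)"]
    unfolding Gamma_def by (auto intro: set_integrable_const_Icc)
qed

lemma Gamma_nonempty:
  assumes "t \<le> S" "x \<in> Gnet N e"
  shows "Gamma N e S t x \<noteq> {}"
proof -
  obtain i where i: "i \<in> {1..N}" "x \<in> ray e i"
    using assms(2) by (auto simp: Gnet_def)
  \<comment> \<open>Standing still by zero speed on edge \<open>i\<close>; the index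
    \<open>0\<close> would be inadmissible when \<open>x\<close> is not the vertex.\<close>
  have "(\<lambda>_. x, \<lambda>_. (i, 0)) \<in> Gamma N e S t x"
    using i assms(1) by (intro Gamma_const) (auto simp: fdyn_def)
  then show ?thesis
    by blast
qed

section \<open>First-order behaviour of test functions\<close>

text \<open>The derivative is taken within the half strip, so at \<open>r = 0\<close> the expansion
  is one-sided in space. Differentiability at the single point \<open>(r, t)\<close> suffices, since
  only one end point is ever compared with it.\<close>

lemma C1_net_expansion:
  assumes C1: "C1_net N e T \<phi> Dx Dt" and i: "i \<in> {1..N}" and r: "r \<ge> 0" and t: "t \<in> {0..T}"
    and \<epsilon>: "\<epsilon> > 0"
  obtains \<delta> where "\<delta> > 0" and
    "\<And>r' s. r' \<ge> 0 \<Longrightarrow> s \<in> {0..T} \<Longrightarrow> \<bar>r' - r\<bar> < \<delta> \<Longrightarrow> \<bar>s - t\<bar> < \<delta> \<Longrightarrow>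
      \<bar>\<phi> (r' *\<^sub>R e i) s - \<phi> (r *\<^sub>R e i) t - (Dx i (r, t) * (r' - r) + Dt i (r, t) * (s - t))\<bar>
        \<le> \<epsilon> * (\<bar>r' - r\<bar> + \<bar>s - t\<bar>)"
proof -
  have "((\<lambda>(r,s). \<phi> (r *\<^sub>R e i) s) has_derivative (\<lambda>(h,k). Dx i (r, t) * h + Dt i (r, t) * k))
      (at (r, t) within {0..} \<times> {0..T})"
    using C1 i r t unfolding C1_net_def by fastforce
  then obtain d where d: "d > 0" "\<And>p. p \<in> {0..} \<times> {0..T} \<Longrightarrow> norm (p - (r, t)) < d \<Longrightarrow>
      norm ((\<lambda>(r,s). \<phi> (r *\<^sub>R e i) s) p - (\<lambda>(r,s). \<phi> (r *\<^sub>R e i) s) (r, t)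
        - (\<lambda>(h,k). Dx i (r, t) * h + Dt i (r, t) * k) (p - (r, t))) \<le> \<epsilon> * norm (p - (r, t))"
    using \<epsilon> unfolding has_derivative_within_alt by blast
  show thesis
  \<comment> \<open>With both coordinate increments below \<open>d / 2\<close> their sum, and hence
    the product norm, stays below \<open>d\<close>.\<close>
  proof (rule that[of "d / 2"])
    fix r' s :: real
    assume *: "r' \<ge> 0" "s \<in> {0..T}" "\<bar>r' - r\<bar> < d / 2" "\<bar>s - t\<bar> < d / 2"
    have n: "norm ((r', s) - (r, t)) \<le> \<bar>r' - r\<bar> + \<bar>s - t\<bar>"
      using norm_Pair_le[of "r' - r" "s - t"] by simp
    then have "norm ((r', s) - (r, t)) < d"
      using * by linarith
    then have "\<bar>\<phi> (r' *\<^sub>R e i) s - \<phi> (r *\<^sub>R e i) t - (Dx i (r, t) * (r' - r) + Dt i (r, t) * (s - t))\<bar>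
        \<le> \<epsilon> * norm ((r', s) - (r, t))"
      using d(2)[of "(r', s)"] * by simp
    also have "\<dots> \<le> \<epsilon> * (\<bar>r' - r\<bar> + \<bar>s - t\<bar>)"
      using n \<epsilon> by (intro mult_left_mono) auto
    finally show "\<bar>\<phi> (r' *\<^sub>R e i) s - \<phi> (r *\<^sub>R e i) t - (Dx i (r, t) * (r' - r) + Dt i (r, t) * (s - t))\<bar>
        \<le> \<epsilon> * (\<bar>r' - r\<bar> + \<bar>s - t\<bar>)" .
  qed (use d in simp)
qed

text \<open>All edges share the function \<open>\<phi> 0\<close> of time, and
  \<open>Dt k (0, t)\<close> is its derivative for every \<open>k\<close>. This is why
  \<open>Dt 1\<close> can stand for the time derivative at the vertex.\<close>

lemma C1_net_Dt_vertex:
  assumes C1: "C1_net N e T \<phi> Dx Dt" and i: "i \<in> {1..N}" and j: "j \<in> {1..N}" and t: "t \<in> {0<..<T}"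
  shows "Dt i (0, t) = Dt j (0, t)"
proof -
  have "((\<lambda>s. \<phi> 0 s) has_real_derivative Dt k (0, t)) (at t within {0..T})" if k: "k \<in> {1..N}" for k
  proof -
    have "((\<lambda>(r,s). \<phi> (r *\<^sub>R e k) s) has_derivative (\<lambda>(h,l). Dx k (0, t) * h + Dt k (0, t) * l))
        (at (0, t) within (\<lambda>s. (0, s)) ` {0..T})"
      by (rule has_derivative_subset[of _ _ _ "{0..} \<times> {0..T}"]) (use C1 k t in \<open>fastforce simp: C1_net_def\<close>)+
    moreover have "((\<lambda>s. (0::real, s)) has_derivative (\<lambda>s. (0, s))) (at t within {0..T})"
      by (intro derivative_intros)
    ultimately have "((\<lambda>(r,s). \<phi> (r *\<^sub>R e k) s) \<circ> (\<lambda>s. (0, s)) has_derivative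
        (\<lambda>(h,l). Dx k (0, t) * h + Dt k (0, t) * l) \<circ> (\<lambda>s. (0, s))) (at t within {0..T})"
      by (intro diff_chain_within)
    then show ?thesis
      by (simp add: has_field_derivative_def o_def)
  qed
  from this[OF i] this[OF j] show ?thesis
    using t at_within_Icc_at[of 0 t T] by (auto intro: DERIV_unique)
qed

end

section \<open>Dynamic programming\<close>

text \<open>The control problem with the measure flow frozen. The minimum that defines the vertex
  cost enters through \<open>ellO_le\<close>, which makes the running cost lower semicontinuous at
  the vertex.\<close>

locale network_control = network N e for N and e :: "nat \<Rightarrow> 'a::euclidean_space" +
  fixes T K :: real and ell :: "nat \<Rightarrow> 'a \<Rightarrow> real \<Rightarrow> real" and ellO :: "real \<Rightarrow> real"
    and g :: "'a \<Rightarrow> real"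
  assumes ell_cont: "\<And>i. i \<in> {1..N} \<Longrightarrow> continuous_on (Gnet N e \<times> {0..T}) (\<lambda>(x,t). ell i x t)"
    and ellO_cont: "continuous_on {0..T} ellO"
    and ellO_le: "\<And>i t. i \<in> {1..N} \<Longrightarrow> t \<in> {0..T} \<Longrightarrow> ellO t \<le> ell i 0 t"
    and ell_bound: "\<And>i x t. i \<in> {1..N} \<Longrightarrow> x \<in> Gnet N e \<Longrightarrow> t \<in> {0..T} \<Longrightarrow> \<bar>ell i x t\<bar> \<le> K"
    and ellO_bound: "\<And>t. t \<in> {0..T} \<Longrightarrow> \<bar>ellO t\<bar> \<le> K"
    and g_bound: "\<And>x. x \<in> Gnet N e \<Longrightarrow> \<bar>g x\<bar> \<le> K"
begin

definition L :: "'a \<Rightarrow> real \<Rightarrow> real" where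
  "L x t = (if x = 0 then ellO t else ell (edge_idx N e x) x t)"

abbreviation u :: "'a \<Rightarrow> real \<Rightarrow> real" where
  "u \<equiv> value_fn N e T L g"

abbreviation cost :: "(real \<Rightarrow> 'a) \<Rightarrow> (real \<Rightarrow> nat \<times> real) \<Rightarrow> real \<Rightarrow> real \<Rightarrow> real" where
  "cost y \<alpha> a b \<equiv> (LINT \<tau>:{a..b}|lborel. L (y \<tau>) \<tau> + (snd (\<alpha> \<tau>))\<^sup>2 / 2)"

lemma L_eq: "i \<in> {1..N} \<Longrightarrow> x \<in> ray e i \<Longrightarrow> x \<noteq> 0 \<Longrightarrow> L x t = ell i x t"
  by (simp add: L_def edge_idx_eq)

text \<open>At the vertex equality may fail, but this direction survives. It lets edge controls that
  start from the vertex be estimated by the edge cost.\<close>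

lemma L_le: "i \<in> {1..N} \<Longrightarrow> x \<in> ray e i \<Longrightarrow> t \<in> {0..T} \<Longrightarrow> L x t \<le> ell i x t"
  using L_eq[of i x t] ellO_le[of i t] by (cases "x = 0") (auto simp: L_def)

lemma L_bound:
  assumes "x \<in> Gnet N e" "t \<in> {0..T}"
  shows "\<bar>L x t\<bar> \<le> K"
proof (cases "x = 0")
  case False
  obtain i where "i \<in> {1..N}" "x \<in> ray e i"
    using assms by (auto simp: Gnet_def)
  then show ?thesis
    using ell_bound assms L_eq False by metis
qed (use ellO_bound assms in \<open>simp add: L_def\<close>)

lemma L_integrable:
  assumes y: "continuous_on {a..b} y" "\<And>\<tau>. \<tau> \<in> {a..b} \<Longrightarrow> y \<tau> \<in> Gnet N e"
    and ab: "0 \<le> a" "b \<le> T"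
  shows "set_integrable lborel {a..b} (\<lambda>\<tau>. L (y \<tau>) \<tau>)"
proof -
  let ?M = "restrict_space borel {a..b}"
  \<comment> \<open>Replaces \<open>edge_idx\<close>, whose measurability is not apparent: away from
    the vertex exactly one summand survives.\<close>
  let ?h = "\<lambda>\<tau>. if y \<tau> = 0 then ellO \<tau> else \<Sum>i\<in>{1..N}. if y \<tau> \<in> ray e i then ell i (y \<tau>) \<tau> else 0"
  have [measurable]: "y \<in> borel_measurable ?M"
    by (rule borel_measurable_continuous_on_restrict[OF y(1)])
  have [measurable]: "ellO \<in> borel_measurable ?M"
    by (rule borel_measurable_continuous_on_restrict[OF continuous_on_subset[OF ellO_cont]])
      (use ab in auto)
  have ell_m: "(\<lambda>\<tau>. ell i (y \<tau>) \<tau>) \<in> borel_measurable ?M" if "i \<in> {1..N}" for i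
  proof (rule borel_measurable_continuous_on_restrict)
    have "continuous_on {a..b} (\<lambda>\<tau>. (\<lambda>(x,t). ell i x t) (y \<tau>, \<tau>))"
      by (rule continuous_on_compose2[OF ell_cont[OF that]])
        (use y ab in \<open>auto intro!: continuous_intros\<close>)
    then show "continuous_on {a..b} (\<lambda>\<tau>. ell i (y \<tau>) \<tau>)"
      by simp
  qed
  have "(\<lambda>\<tau>. if y \<tau> \<in> ray e i then ell i (y \<tau>) \<tau> else 0) \<in> borel_measurable ?M"
    if "i \<in> {1..N}" for i
  proof -
    have [measurable]: "ray e i \<in> sets borel"
      using closed_ray[OF that] by (rule borel_closed)
    show ?thesis
      using ell_m[OF that] by measurable
  qed
  then have "?h \<in> borel_measurable ?M"
    by measurable
  moreover have "L (y \<tau>) \<tau> = ?h \<tau>" if \<tau>: "\<tau> \<in> {a..b}" for \<tau>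
  proof (cases "y \<tau> = 0")
    case False
    obtain i where i: "i \<in> {1..N}" "y \<tau> \<in> ray e i"
      using y(2)[OF \<tau>] by (auto simp: Gnet_def)
    have "(\<Sum>j\<in>{1..N}. if y \<tau> \<in> ray e j then ell j (y \<tau>) \<tau> else 0)
        = (\<Sum>j\<in>{1..N}. if j = i then ell i (y \<tau>) \<tau> else 0)"
      using i ray_unique False by (intro sum.cong) fastforce+
    then show ?thesis
      using i False L_eq by simp
  qed (simp add: L_def)
  ultimately have "(\<lambda>\<tau>. L (y \<tau>) \<tau>) \<in> borel_measurable ?M"
    by (subst measurable_cong[where g = ?h]) (auto simp: space_restrict_space)
  then have m: "set_borel_measurable lborel {a..b} (\<lambda>\<tau>. L (y \<tau>) \<tau>)"
    by (simp add: set_borel_measurable_def borel_measurable_restrict_space_iff)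
  have "norm (L (y \<tau>) \<tau>) \<le> norm K" if "\<tau> \<in> {a..b}" for \<tau>
    using L_bound[OF y(2)[OF that], of \<tau>] that ab by auto
  then have "AE \<tau> in lborel. \<tau> \<in> {a..b} \<longrightarrow> norm (L (y \<tau>) \<tau>) \<le> norm K"
    by simp
  then show ?thesis
    by (rule set_integrable_bound[OF set_integrable_const_Icc m])
qed

lemma cost_integrable:
  assumes G: "(y, \<alpha>) \<in> Gamma N e S t x" and t: "0 \<le> t" "S \<le> T" and sub: "t \<le> a" "b \<le> S"
  shows "set_integrable lborel {a..b} (\<lambda>\<tau>. L (y \<tau>) \<tau>)"
    and "set_integrable lborel {a..b} (\<lambda>\<tau>. (snd (\<alpha> \<tau>))\<^sup>2 / 2)"
    and "set_integrable lborel {a..b} (\<lambda>\<tau>. L (y \<tau>) \<tau> + (snd (\<alpha> \<tau>))\<^sup>2 / 2)"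
proof -
  show 1: "set_integrable lborel {a..b} (\<lambda>\<tau>. L (y \<tau>) \<tau>)"
    using sub t GammaD(5)[OF G]
    by (intro L_integrable continuous_on_subset[OF Gamma_continuous[OF G]]) auto
  show 2: "set_integrable lborel {a..b} (\<lambda>\<tau>. (snd (\<alpha> \<tau>))\<^sup>2 / 2)"
    using sub by (intro set_integrable_divide set_integrable_subset[OF GammaD(3)[OF G]]) auto
  show "set_integrable lborel {a..b} (\<lambda>\<tau>. L (y \<tau>) \<tau> + (snd (\<alpha> \<tau>))\<^sup>2 / 2)"
    by (rule set_integral_add(1)[OF 1 2])
qed

lemma cost_split:
  assumes G: "(y, \<alpha>) \<in> Gamma N e S t x" and t: "0 \<le> t" "S \<le> T" and "t \<le> a" "a \<le> s" "s \<le> b" "b \<le> S"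
  shows "cost y \<alpha> a b = cost y \<alpha> a s + cost y \<alpha> s b"
  using assms cost_integrable(3)[OF G t, of a b] by (intro set_lebesgue_integral_combine[symmetric]) auto

text \<open>The bound is asked on the half-open interval only. At the last visit to the vertex
  \<open>L\<close> equals \<open>ellO\<close>, which may lie below the cost of the edge entered
  next; that single time has measure zero.\<close>

lemma cost_ge:
  assumes G: "(y, \<alpha>) \<in> Gamma N e S t x" and t: "0 \<le> t" "S \<le> T" and ab: "t \<le> a" "a \<le> b" "b \<le> S"
    and c: "\<And>\<tau>. \<tau> \<in> {a<..b} \<Longrightarrow> c \<le> L (y \<tau>) \<tau>"
  shows "(b - a) * c + (LINT \<tau>:{a..b}|lborel. (snd (\<alpha> \<tau>))\<^sup>2 / 2) \<le> cost y \<alpha> a b"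
proof -
  note int = cost_integrable[OF G t ab(1,3)]
  have "(b - a) * c = (LINT \<tau>:{a..b}|lborel. c)"
    using ab set_lebesgue_integral_const_Icc[of a b c] by simp
  also have "\<dots> \<le> (LINT \<tau>:{a..b}|lborel. L (y \<tau>) \<tau>)"
  proof (rule set_integral_mono_AE[OF set_integrable_const_Icc int(1)])
    show "AE \<tau>\<in>{a..b} in lborel. c \<le> L (y \<tau>) \<tau>"
      using AE_lborel_singleton[of a] by eventually_elim (use c in auto)
  qed
  finally show ?thesis
    by (simp add: set_integral_add(2)[OF int(1,2)])
qed

lemma energy_nonneg: "0 \<le> (LINT \<tau>:{a..b}|lborel. (snd (\<alpha> \<tau>))\<^sup>2 / 2 :: real)"
  unfolding set_lebesgue_integral_def by (intro integral_nonneg_AE AE_I2) (simp add: indicator_def)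

lemma Jcost_eq: "Jcost t T L g (y, \<alpha>) = cost y \<alpha> t T + g (y T)"
  by (simp add: Jcost_def)

text \<open>The running cost loses at most \<open>(T - t) * K\<close> and the final cost at most
  \<open>K\<close>. This both bounds the value from below and bounds the energy of
  near-minimizers.\<close>

lemma Jcost_ge:
  assumes G: "(y, \<alpha>) \<in> Gamma N e T t x" and t: "0 \<le> t" "t \<le> T"
  shows "(LINT \<tau>:{t..T}|lborel. (snd (\<alpha> \<tau>))\<^sup>2 / 2) - (T - t + 1) * K \<le> Jcost t T L g (y, \<alpha>)"
proof -
  have "- K \<le> L (y \<tau>) \<tau>" if "\<tau> \<in> {t<..T}" for \<tau>
    using L_bound[of "y \<tau>" \<tau>] GammaD(5)[OF G, of \<tau>] that t by fastforce
  from cost_ge[OF G t(1) order_refl order_refl t(2) order_refl this]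
  have "(T - t) * - K + (LINT \<tau>:{t..T}|lborel. (snd (\<alpha> \<tau>))\<^sup>2 / 2) \<le> cost y \<alpha> t T" .
  then show ?thesis
    using g_bound[of "y T"] GammaD(5)[OF G, of T] t by (simp add: Jcost_eq algebra_simps)
qed

text \<open>Together with \<open>Gamma_nonempty\<close> this ensures that the real
  \<open>Inf\<close> in \<open>value_fn\<close> is a genuine infimum.\<close>

lemma Jcost_bdd_below:
  assumes "0 \<le> t" "t \<le> T"
  shows "bdd_below (Jcost t T L g ` Gamma N e T t x)"
proof (rule bdd_belowI2)
  fix p assume "p \<in> Gamma N e T t x"
  then have "(fst p, snd p) \<in> Gamma N e T t x"
    by simp
  from Jcost_ge[OF this assms] show "- ((T - t + 1) * K) \<le> Jcost t T L g p"
    using energy_nonneg[of t T "snd p"] by simp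
qed

lemma value_le_Jcost:
  assumes "p \<in> Gamma N e T t x" "0 \<le> t" "t < T"
  shows "u x t \<le> Jcost t T L g p"
  using assms Jcost_bdd_below[of t x] by (auto simp: value_fn_def intro!: cInf_lower)

text \<open>Any admissible piece on \<open>[t, s]\<close> followed by any continuation is a
  competitor from \<open>(x, t)\<close>; then the infimum over continuations is taken.\<close>

lemma value_le_dynamic:
  assumes G: "(y, \<alpha>) \<in> Gamma N e s t x" and s: "0 \<le> t" "t < s" "s < T"
  shows "u x t \<le> cost y \<alpha> t s + u (y s) s"
proof -
  have "u x t - cost y \<alpha> t s \<le> Jcost s T L g p" if p: "p \<in> Gamma N e T s (y s)" for p
  proof -
    obtain y2 \<alpha>2 where p_eq: "p = (y2, \<alpha>2)"
      by fastforce
    note G2 = p[unfolded p_eq]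
    let ?y = "\<lambda>\<tau>. if \<tau> < s then y \<tau> else y2 \<tau>" and ?\<alpha> = "\<lambda>\<tau>. if \<tau> < s then \<alpha> \<tau> else \<alpha>2 \<tau>"
    have Gc: "(?y, ?\<alpha>) \<in> Gamma N e T t x"
      by (rule Gamma_concat[OF G G2]) (use s in auto)
    have "cost ?y ?\<alpha> t s = cost y \<alpha> t s"
      using s by (intro set_lebesgue_integral_cong_Ico cost_integrable(3)[OF Gc]
          cost_integrable(3)[OF G]) auto
    moreover have "cost ?y ?\<alpha> s T = cost y2 \<alpha>2 s T"
      by (rule set_lebesgue_integral_cong) auto
    moreover have "cost ?y ?\<alpha> t T = cost ?y ?\<alpha> t s + cost ?y ?\<alpha> s T"
      using s by (intro cost_split[OF Gc]) auto
    ultimately have "Jcost t T L g (?y, ?\<alpha>) = cost y \<alpha> t s + Jcost s T L g p"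
      unfolding Jcost_eq p_eq using s by simp
    then show ?thesis
      using value_le_Jcost[OF Gc] s by simp
  qed
  moreover have "Gamma N e T s (y s) \<noteq> {}"
    using s GammaD(5)[OF G, of s] by (intro Gamma_nonempty) auto
  ultimately have "u x t - cost y \<alpha> t s \<le> Inf (Jcost s T L g ` Gamma N e T s (y s))"
    by (intro cInf_greatest) auto
  then show ?thesis
    using s by (simp add: value_fn_def)
qed

text \<open>The converse half of dynamic programming. Every tail of a near-minimizer is a competitor
  for its own starting point, so one pair loses at most \<open>\<eta>\<close> at all intermediate
  times simultaneously.\<close>

lemma almost_optimal:
  assumes t: "0 \<le> t" "t < T" and x: "x \<in> Gnet N e" and \<eta>: "\<eta> > 0"
  obtains y \<alpha> where "(y, \<alpha>) \<in> Gamma N e T t x"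
    and "\<And>s. s \<in> {t..<T} \<Longrightarrow> cost y \<alpha> t s + u (y s) s \<le> u x t + \<eta>"
    and "(LINT \<tau>:{t..T}|lborel. (snd (\<alpha> \<tau>))\<^sup>2 / 2) \<le> u x t + \<eta> + (T - t + 1) * K"
proof -
  have ne: "Jcost t T L g ` Gamma N e T t x \<noteq> {}"
    using Gamma_nonempty[of t T x] t x by simp
  have "Inf (Jcost t T L g ` Gamma N e T t x) < u x t + \<eta>"
    using t \<eta> by (simp add: value_fn_def)
  from cInf_lessD[OF ne this] obtain y \<alpha>
    where G: "(y, \<alpha>) \<in> Gamma N e T t x" and J: "Jcost t T L g (y, \<alpha>) < u x t + \<eta>"
    by auto
  show thesis
  proof (rule that[OF G])
    show "(LINT \<tau>:{t..T}|lborel. (snd (\<alpha> \<tau>))\<^sup>2 / 2) \<le> u x t + \<eta> + (T - t + 1) * K"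
      using Jcost_ge[OF G] t J by linarith
  next
    fix s assume s: "s \<in> {t..<T}"
    have "(y, \<alpha>) \<in> Gamma N e T s (y s)"
      using Gamma_tail[OF G] s by auto
    then have "u (y s) s \<le> Jcost s T L g (y, \<alpha>)"
      using value_le_Jcost s t by auto
    moreover have "cost y \<alpha> t T = cost y \<alpha> t s + cost y \<alpha> s T"
      using s t by (intro cost_split[OF G]) auto
    ultimately show "cost y \<alpha> t s + u (y s) s \<le> u x t + \<eta>"
      using J by (simp add: Jcost_eq)
  qed
qed

text \<open>The energy bound on almost optimal controls makes the corresponding paths
  equicontinuous at the initial time.\<close>

lemma almost_optimal_short_time:
  assumes t: "0 \<le> t" "t < T" and x: "x \<in> Gnet N e" and \<eta>: "\<eta> > 0"
  obtains h y \<alpha> where "0 < h" "h < \<eta>" "t + h < T" "(y, \<alpha>) \<in> Gamma N e T t x"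
    and "\<And>s. s \<in> {t..t+h} \<Longrightarrow> norm (y s - x) < \<eta>"
    and "cost y \<alpha> t (t + h) + u (y (t + h)) (t + h) \<le> u x t + \<eta> * h"
proof -
  define M where "M = \<bar>u x t + \<eta> + (T - t + 1) * K\<bar> + 1"
  \<comment> \<open>With this slope \<open>a * \<eta> = 2 * M\<close>. The energy takes less than
    one \<open>M\<close>, and \<open>h < \<eta> / a\<close> keeps the time term of Young's
    inequality within the other.\<close>
  define a where "a = 2 * M / \<eta>"
  have M: "M > 0"
    by (simp add: M_def)
  then have a: "a > 0" "a * \<eta> = 2 * M"
    using \<eta> by (simp_all add: a_def)
  obtain h where h: "0 < h" "h < 1" "h < T - t" "h < \<eta>" "h < \<eta> / a"
  proof -
    have "0 < Min {1, T - t, \<eta>, \<eta> / a}"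
      using a \<eta> t by simp
    then obtain h where "0 < h" "h < Min {1, T - t, \<eta>, \<eta> / a}"
      using dense by blast
    then show thesis
      by (intro that) auto
  qed
  \<comment> \<open>The tolerance is fixed after \<open>h\<close>, so that dividing by
    \<open>h\<close> later leaves only \<open>\<eta>\<close>. Since \<open>h < 1\<close>, the bound
    \<open>M\<close> still covers it.\<close>
  then have "\<eta> * h > 0"
    using \<eta> by simp
  from almost_optimal[OF t x this] obtain y \<alpha> where G: "(y, \<alpha>) \<in> Gamma N e T t x"
    and opt: "\<And>s. s \<in> {t..<T} \<Longrightarrow> cost y \<alpha> t s + u (y s) s \<le> u x t + \<eta> * h"
    and en: "(LINT \<tau>:{t..T}|lborel. (snd (\<alpha> \<tau>))\<^sup>2 / 2) \<le> u x t + \<eta> * h + (T - t + 1) * K"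
    by blast
  have "norm (y s - x) < \<eta>" if s: "s \<in> {t..t+h}" for s
  proof -
    have sT: "t \<le> s" "s \<le> T"
      using s h by auto
    have "(LINT \<tau>:{t..T}|lborel. (snd (\<alpha> \<tau>))\<^sup>2 / 2) =
        (LINT \<tau>:{t..s}|lborel. (snd (\<alpha> \<tau>))\<^sup>2 / 2) + (LINT \<tau>:{s..T}|lborel. (snd (\<alpha> \<tau>))\<^sup>2 / 2)"
      using sT t by (intro set_lebesgue_integral_combine[symmetric] cost_integrable(2)[OF G]) auto
    moreover have "\<eta> * h \<le> \<eta> * 1"
      using h \<eta> by (intro mult_left_mono) auto
    ultimately have E: "(LINT \<tau>:{t..s}|lborel. (snd (\<alpha> \<tau>))\<^sup>2 / 2) < M"
      using en energy_nonneg[of s T \<alpha>] unfolding M_def by linarith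
    have "a * norm (y s - y t) \<le> (LINT \<tau>:{t..s}|lborel. (snd (\<alpha> \<tau>))\<^sup>2 / 2) + (s - t) * (a\<^sup>2 / 2)"
      using Gamma_displacement[OF G order_refl sT] a by simp
    moreover have "(s - t) * (a\<^sup>2 / 2) \<le> (\<eta> / a) * (a\<^sup>2 / 2)"
      using s h by (intro mult_right_mono) auto
    moreover have "(\<eta> / a) * (a\<^sup>2 / 2) = M"
      using a by (simp add: power2_eq_square field_simps)
    ultimately have "a * norm (y s - y t) < a * \<eta>"
      using E a by linarith
    then have "norm (y s - y t) < \<eta>"
      using a(1) by (simp only: mult_less_cancel_left_pos)
    then show ?thesis
      using Gamma_initial[OF G] t by simp
  qed
  then show thesis
    using that[OF h(1,4) _ G] opt[of "t + h"] h by auto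
qed

end

section \<open>Viscosity inequalities\<close>

text \<open>The concave parabola in \<open>a\<close> peaks at \<open>- p\<close>; on the half line
  the supremum is attained at the projection \<open>max 0 (- p)\<close>.\<close>

lemma Hdown_eq: "Hdown l p = (max 0 (- p))\<^sup>2 / 2 - l"
  unfolding Hdown_def
proof (rule cSup_eq_maximum)
  show "(max 0 (- p))\<^sup>2 / 2 - l \<in> (\<lambda>a. - p * a - a\<^sup>2 / 2 - l) ` {0..}"
    by (rule image_eqI[of _ _ "max 0 (- p)"]) (auto simp: max_def power2_eq_square)
next
  fix z assume "z \<in> (\<lambda>a. - p * a - a\<^sup>2 / 2 - l) ` {0..}"
  then obtain a where a: "a \<ge> 0" "z = - p * a - a\<^sup>2 / 2 - l"
    by auto
  have "- p * a \<le> max 0 (- p) * a"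
    using a by (intro mult_right_mono) auto
  then show "z \<le> (max 0 (- p))\<^sup>2 / 2 - l"
    using a(2) sum_squares_bound[of "max 0 (- p)" a] by simp
qed

lemma HO_le_iff:
  assumes "N \<ge> 1"
  shows "HO N lO l p \<le> c \<longleftrightarrow> - lO \<le> c \<and> (\<forall>i\<in>{1..N}. Hdown (l i) (p i) \<le> c)"
  using assms unfolding HO_def by (subst max.bounded_iff, subst Max_le_iff) auto

text \<open>Lets \<open>\<epsilon>\<close> tend to \<open>0\<close>. Restricting to
  \<open>\<epsilon> \<le> 1\<close> allows quadratic errors to be absorbed into linear ones.\<close>

lemma le_of_le_add_mult:
  fixes A B C :: real
  assumes "\<And>\<epsilon>. 0 < \<epsilon> \<Longrightarrow> \<epsilon> \<le> 1 \<Longrightarrow> A \<le> B + \<epsilon> * C"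
  shows "A \<le> B"
proof (rule field_le_epsilon)
  fix \<delta> :: real assume \<delta>: "\<delta> > 0"
  define \<epsilon> where "\<epsilon> = min 1 (\<delta> / (\<bar>C\<bar> + 1))"
  have \<epsilon>: "0 < \<epsilon>" "\<epsilon> \<le> 1"
    using \<delta> by (auto simp: \<epsilon>_def)
  have "\<epsilon> * C \<le> \<epsilon> * (\<bar>C\<bar> + 1)"
    using \<epsilon> by (intro mult_left_mono) auto
  also have "\<dots> \<le> \<delta> / (\<bar>C\<bar> + 1) * (\<bar>C\<bar> + 1)"
    unfolding \<epsilon>_def by (intro mult_right_mono) auto
  also have "\<dots> = \<delta>"
    by simp
  finally show "A \<le> B + \<delta>"
    using assms[OF \<epsilon>] by linarith
qed

text \<open>Used at the vertex, where the edge on which a near-optimal path ends is known only after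
  the radius has been fixed.\<close>

lemma finite_common_radius:
  assumes "finite I" and "\<And>i. i \<in> I \<Longrightarrow> \<exists>\<delta>>0::real. P i \<delta>"
    and mono: "\<And>i \<delta> \<delta>'. P i \<delta> \<Longrightarrow> 0 < \<delta>' \<Longrightarrow> \<delta>' \<le> \<delta> \<Longrightarrow> P i \<delta>'"
  shows "\<exists>\<delta>>0. \<forall>i\<in>I. P i \<delta>"
  using assms(1,2)
proof (induction I rule: finite_induct)
  case empty
  then show ?case
    by (auto intro: exI[of _ 1])
next
  case (insert i I)
  then obtain \<delta> \<delta>' where *: "\<delta> > 0" "\<forall>j\<in>I. P j \<delta>" "\<delta>' > 0" "P i \<delta>'"
    by blast
  have "P j (min \<delta> \<delta>')" if "j \<in> insert i I" for j
    using that * mono[of j _ "min \<delta> \<delta>'"] by auto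
  then show ?case
    using * by (intro exI[of _ "min \<delta> \<delta>'"]) auto
qed

context network_control
begin

lemma ell_near:
  assumes i: "i \<in> {1..N}" and x: "x \<in> Gnet N e" and t: "t \<in> {0..T}" and \<epsilon>: "\<epsilon> > 0"
  obtains \<delta> where "\<delta> > 0" and
    "\<And>y s. y \<in> Gnet N e \<Longrightarrow> s \<in> {0..T} \<Longrightarrow> norm (y - x) < \<delta> \<Longrightarrow> \<bar>s - t\<bar> < \<delta> \<Longrightarrow>
      \<bar>ell i y s - ell i x t\<bar> < \<epsilon>"
proof -
  have "(x, t) \<in> Gnet N e \<times> {0..T}"
    using x t by simp
  then obtain d where d: "d > 0" "\<And>p. p \<in> Gnet N e \<times> {0..T} \<Longrightarrow> dist p (x, t) < d \<Longrightarrow>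
      dist ((\<lambda>(x,t). ell i x t) p) ((\<lambda>(x,t). ell i x t) (x, t)) < \<epsilon>"
    using ell_cont[OF i] \<epsilon> unfolding continuous_on_iff by blast
  show thesis
  proof (rule that[of "d / 2"])
    fix y s assume *: "y \<in> Gnet N e" "s \<in> {0..T}" "norm (y - x) < d / 2" "\<bar>s - t\<bar> < d / 2"
    have "dist (y, s) (x, t) < d"
      using norm_Pair_le[of "y - x" "s - t"] * by (simp add: dist_norm)
    then show "\<bar>ell i y s - ell i x t\<bar> < \<epsilon>"
      using d(2)[of "(y, s)"] * by (simp add: dist_real_def)
  qed (use d in simp)
qed

lemma ellO_near:
  assumes t: "t \<in> {0..T}" and \<epsilon>: "\<epsilon> > 0"
  obtains \<delta> where "\<delta> > 0" and
    "\<And>s. s \<in> {0..T} \<Longrightarrow> \<bar>s - t\<bar> < \<delta> \<Longrightarrow> \<bar>ellO s - ellO t\<bar> < \<epsilon>"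
  using ellO_cont t \<epsilon> unfolding continuous_on_iff dist_real_def by metis

section \<open>Subsolution property\<close>

text \<open>Dynamic programming along motion with constant velocity \<open>b\<close>, divided by the
  time step. Separating the control \<open>(k, a)\<close> from \<open>b\<close> covers both travel
  along an edge, \<open>k = i\<close> and \<open>b = a\<close>, and waiting at the vertex,
  \<open>k = 0\<close> and \<open>a = b = 0\<close>. The hypothesis \<open>run\<close> is upper
  semicontinuity of the running cost along this one path; its limit \<open>l\<close> is an edge cost
  in the first case and \<open>ellO t\<close> in the second.\<close>

lemma subsolution_along_constant_control:
  assumes C1: "C1_net N e T \<phi> Dx Dt"
    and max: "loc_max_net N e T (\<lambda>y s. u y s - \<phi> y s) (r *\<^sub>R e i) t"
    and i: "i \<in> {1..N}" and r: "r \<ge> 0" and t: "t \<in> {0<..<T}"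
    and k: "k \<le> N" "fdyn e (k, a) = b *\<^sub>R e i"
    and adm: "h1 > 0" "\<And>\<tau>. \<tau> \<in> {t..t+h1} \<Longrightarrow> r + (\<tau> - t) * b \<ge> 0 \<and> (r + (\<tau> - t) * b = 0 \<or> k = i)"
    and run: "\<And>\<epsilon>. \<epsilon> > 0 \<Longrightarrow> \<exists>h>0. \<forall>\<tau>\<in>{t..<t+h}. \<tau> \<le> T \<longrightarrow> r + (\<tau> - t) * b \<ge> 0 \<longrightarrow>
      L ((r + (\<tau> - t) * b) *\<^sub>R e i) \<tau> \<le> l + \<epsilon>"
  shows "- Dt i (r, t) - b * Dx i (r, t) - a\<^sup>2 / 2 - l \<le> 0"
proof (rule le_of_le_add_mult[of _ _ "\<bar>b\<bar> + 2"])
  fix \<epsilon> :: real assume \<epsilon>: "\<epsilon> > 0"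
  obtain \<delta> where \<delta>: "\<delta> > 0" and expand:
    "\<And>r' s. r' \<ge> 0 \<Longrightarrow> s \<in> {0..T} \<Longrightarrow> \<bar>r' - r\<bar> < \<delta> \<Longrightarrow> \<bar>s - t\<bar> < \<delta> \<Longrightarrow>
      \<bar>\<phi> (r' *\<^sub>R e i) s - \<phi> (r *\<^sub>R e i) t - (Dx i (r, t) * (r' - r) + Dt i (r, t) * (s - t))\<bar>
        \<le> \<epsilon> * (\<bar>r' - r\<bar> + \<bar>s - t\<bar>)"
    using C1_net_expansion[OF C1 i r _ \<epsilon>, of t] t by auto
  obtain h2 where h2: "h2 > 0" "\<forall>\<tau>\<in>{t..<t+h2}. \<tau> \<le> T \<longrightarrow> r + (\<tau> - t) * b \<ge> 0 \<longrightarrow>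
      L ((r + (\<tau> - t) * b) *\<^sub>R e i) \<tau> \<le> l + \<epsilon>"
    using run[OF \<epsilon>] by blast
  obtain d where d: "d > 0" "\<And>y s. y \<in> Gnet N e \<Longrightarrow> s \<in> {0..T} \<Longrightarrow> gdist N e y (r *\<^sub>R e i) < d \<Longrightarrow>
      \<bar>s - t\<bar> < d \<Longrightarrow> u y s - \<phi> y s \<le> u (r *\<^sub>R e i) t - \<phi> (r *\<^sub>R e i) t"
    using max unfolding loc_max_net_def by blast
  \<comment> \<open>The first entry keeps the displacement \<open>\<bar>h * b\<bar>\<close> and the
    time step \<open>h\<close> jointly below \<open>\<delta>\<close> and \<open>d\<close>; taking
    half of \<open>m\<close> makes every inequality strict.\<close>
  define m where "m = min (min \<delta> d / (\<bar>b\<bar> + 1)) (min (min h1 h2) (T - t))"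
  define h where "h = m / 2"
  have "m > 0"
    using \<delta> d(1) h2(1) adm(1) t by (simp add: m_def)
  then have h: "0 < h" "h < min \<delta> d / (\<bar>b\<bar> + 1)" "h < h1" "h < h2" "t + h < T"
    using min.cobounded1[of "min \<delta> d / (\<bar>b\<bar> + 1)" "min (min h1 h2) (T - t)"]
      min.cobounded2[of "min \<delta> d / (\<bar>b\<bar> + 1)" "min (min h1 h2) (T - t)"]
    unfolding h_def m_def[symmetric] by linarith+
  have "h * (\<bar>b\<bar> + 1) < min \<delta> d"
    using h(2) by (simp add: pos_less_divide_eq)
  moreover have "h * (\<bar>b\<bar> + 1) = \<bar>h * b\<bar> + h"
    using h(1) by (simp add: abs_mult algebra_simps)
  ultimately have small: "\<bar>h * b\<bar> < \<delta>" "\<bar>h * b\<bar> < d" "h < \<delta>" "h < d"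
    using h(1) by linarith+
  define y where "y = (\<lambda>\<tau>. (r + (\<tau> - t) * b) *\<^sub>R e i)"
  have pos: "r + (\<tau> - t) * b \<ge> 0" if "\<tau> \<in> {t..t+h}" for \<tau>
    using adm(2)[of \<tau>] that h by auto
  have G: "(y, \<lambda>_. (k, a)) \<in> Gamma N e (t + h) t (r *\<^sub>R e i)"
  proof (rule Gamma_const)
    fix \<tau> assume \<tau>: "\<tau> \<in> {t..t+h}"
    show "y \<tau> = r *\<^sub>R e i + (\<tau> - t) *\<^sub>R fdyn e (k, a)"
      by (simp add: y_def k(2) algebra_simps)
    assume "y \<tau> \<noteq> 0"
    then have "k = i"
      using adm(2)[of \<tau>] \<tau> h by (auto simp: y_def)
    then show "k \<noteq> 0 \<and> y \<tau> \<in> ray e k"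
      using i pos[OF \<tau>] scaleR_mem_ray by (auto simp: y_def)
  qed (use h k in auto)
  have le: "L (y \<tau>) \<tau> + a\<^sup>2 / 2 \<le> l + \<epsilon> + a\<^sup>2 / 2" if "\<tau> \<in> {t..t+h}" for \<tau>
    using h2(2) that h pos[OF that] by (auto simp: y_def)
  have "cost y (\<lambda>_. (k, a)) t (t + h) \<le> (LINT \<tau>:{t..t+h}|lborel. l + \<epsilon> + a\<^sup>2 / 2)"
    using le cost_integrable(3)[OF G, of t "t + h"] h t
    by (intro set_integral_mono set_integrable_const_Icc) auto
  also have "\<dots> = h * (l + \<epsilon> + a\<^sup>2 / 2)"
    using h(1) by (subst set_lebesgue_integral_const_Icc) auto
  finally have cost: "cost y (\<lambda>_. (k, a)) t (t + h) \<le> h * (l + \<epsilon> + a\<^sup>2 / 2)" .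
  have dyn: "u (r *\<^sub>R e i) t \<le> cost y (\<lambda>_. (k, a)) t (t + h) + u (y (t + h)) (t + h)"
    using value_le_dynamic[OF G] h t by auto
  have yh: "y (t + h) = (r + h * b) *\<^sub>R e i" "r + h * b \<ge> 0"
    using pos[of "t + h"] h(1) by (simp_all add: y_def)
  have "gdist N e (y (t + h)) (r *\<^sub>R e i) = \<bar>h * b\<bar>"
  proof -
    have "y (t + h) - r *\<^sub>R e i = (h * b) *\<^sub>R e i"
      by (simp add: yh(1) scaleR_left_distrib)
    then show ?thesis
      using gdist_same_ray[OF i, of "y (t + h)" "r *\<^sub>R e i"] scaleR_mem_ray yh r norm_e[OF i]
      by (simp add: dist_norm)
  qed
  moreover have "y (t + h) \<in> Gnet N e"
    using ray_subset_Gnet[OF i] scaleR_mem_ray[OF yh(2), of i] by (auto simp: yh)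
  ultimately have "u (y (t + h)) (t + h) - \<phi> (y (t + h)) (t + h) \<le> u (r *\<^sub>R e i) t - \<phi> (r *\<^sub>R e i) t"
    using d(2)[of "y (t + h)" "t + h"] small h t by auto
  moreover have "\<bar>\<phi> (y (t + h)) (t + h) - \<phi> (r *\<^sub>R e i) t - (Dx i (r, t) * (h * b) + Dt i (r, t) * h)\<bar>
      \<le> \<epsilon> * (\<bar>h * b\<bar> + h)"
    using expand[of "r + h * b" "t + h"] small h t yh by auto
  moreover have "\<epsilon> * (\<bar>h * b\<bar> + h) = h * (\<epsilon> * (\<bar>b\<bar> + 1))"
    using h(1) by (simp add: abs_mult algebra_simps)
  ultimately have "- (Dx i (r, t) * (h * b) + Dt i (r, t) * h) - h * (\<epsilon> * (\<bar>b\<bar> + 1))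
      \<le> h * (l + \<epsilon> + a\<^sup>2 / 2)"
    using dyn cost by linarith
  \<comment> \<open>Of the factor, \<open>\<bar>b\<bar> + 1\<close> is the expansion error and
    \<open>1\<close> the error in the running cost.\<close>
  then have "h * (- Dt i (r, t) - b * Dx i (r, t) - a\<^sup>2 / 2 - l) \<le> h * (\<epsilon> * (\<bar>b\<bar> + 2))"
    by (simp add: algebra_simps)
  then show "- Dt i (r, t) - b * Dx i (r, t) - a\<^sup>2 / 2 - l \<le> 0 + \<epsilon> * (\<bar>b\<bar> + 2)"
    using h(1) by (simp only: mult_le_cancel_left_pos add_0)
qed

text \<open>Inside an edge both directions are admissible for a short time, whereas from the vertex
  only outward motion is. This restriction on \<open>a\<close> is what turns the edge Hamiltonian
  into \<open>Hdown\<close>.\<close>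

lemma subsolution_edge_control:
  assumes C1: "C1_net N e T \<phi> Dx Dt"
    and max: "loc_max_net N e T (\<lambda>y s. u y s - \<phi> y s) (r *\<^sub>R e i) t"
    and i: "i \<in> {1..N}" and r: "r \<ge> 0" and t: "t \<in> {0<..<T}" and a: "r > 0 \<or> a \<ge> 0"
  shows "- Dt i (r, t) - a * Dx i (r, t) - a\<^sup>2 / 2 - ell i (r *\<^sub>R e i) t \<le> 0"
proof -
  \<comment> \<open>Up to this time the path cannot cross the vertex, even when \<open>a\<close>
    points towards it.\<close>
  define h1 where "h1 = (if r > 0 then r / (\<bar>a\<bar> + 1) else 1)"
  have h1: "h1 > 0"
    by (simp add: h1_def)
  have adm: "r + (\<tau> - t) * a \<ge> 0 \<and> (r + (\<tau> - t) * a = 0 \<or> i = i)" if \<tau>: "\<tau> \<in> {t..t+h1}" for \<tau>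
  proof (cases "r > 0")
    case True
    have "\<bar>(\<tau> - t) * a\<bar> = (\<tau> - t) * \<bar>a\<bar>"
      using \<tau> by (simp add: abs_mult)
    also have "\<dots> \<le> h1 * (\<bar>a\<bar> + 1)"
      using \<tau> h1 by (intro mult_mono) auto
    also have "\<dots> = r"
      using True by (simp add: h1_def)
    finally show ?thesis
      by simp
  next
    case False
    then show ?thesis
      using a r \<tau> by simp
  qed
  have run: "\<exists>h>0. \<forall>\<tau>\<in>{t..<t+h}. \<tau> \<le> T \<longrightarrow> r + (\<tau> - t) * a \<ge> 0 \<longrightarrow>
      L ((r + (\<tau> - t) * a) *\<^sub>R e i) \<tau> \<le> ell i (r *\<^sub>R e i) t + \<epsilon>" if \<epsilon>: "\<epsilon> > 0" for \<epsilon>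
  proof -
    have "r *\<^sub>R e i \<in> Gnet N e"
      using ray_subset_Gnet[OF i] scaleR_mem_ray[OF r] by blast
    from ell_near[OF i this _ \<epsilon>, of t] t obtain \<delta> where \<delta>: "\<delta> > 0"
      "\<And>y s. y \<in> Gnet N e \<Longrightarrow> s \<in> {0..T} \<Longrightarrow> norm (y - r *\<^sub>R e i) < \<delta> \<Longrightarrow> \<bar>s - t\<bar> < \<delta> \<Longrightarrow>
        \<bar>ell i y s - ell i (r *\<^sub>R e i) t\<bar> < \<epsilon>"
      by auto
    show ?thesis
    proof (intro exI[of _ "\<delta> / (\<bar>a\<bar> + 1)"] conjI ballI impI)
      fix \<tau> assume \<tau>: "\<tau> \<in> {t..<t + \<delta> / (\<bar>a\<bar> + 1)}" "\<tau> \<le> T" "r + (\<tau> - t) * a \<ge> 0"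
      let ?y = "(r + (\<tau> - t) * a) *\<^sub>R e i"
      have "\<tau> - t < \<delta> / (\<bar>a\<bar> + 1)"
        using \<tau> by auto
      then have "(\<tau> - t) * (\<bar>a\<bar> + 1) < \<delta>"
        by (simp add: pos_less_divide_eq)
      moreover have "(\<tau> - t) * (\<bar>a\<bar> + 1) = \<bar>(\<tau> - t) * a\<bar> + (\<tau> - t)"
        using \<tau> by (simp add: abs_mult distrib_left)
      ultimately have "\<bar>(\<tau> - t) * a\<bar> < \<delta>" "\<bar>\<tau> - t\<bar> < \<delta>"
        using \<tau> by auto
      moreover have "?y - r *\<^sub>R e i = ((\<tau> - t) * a) *\<^sub>R e i"
        by (simp add: algebra_simps)
      moreover have "?y \<in> ray e i"
        by (rule scaleR_mem_ray[OF \<tau>(3)])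
      ultimately have "\<bar>ell i ?y \<tau> - ell i (r *\<^sub>R e i) t\<bar> < \<epsilon>"
        using \<tau> t norm_e[OF i] ray_subset_Gnet[OF i] by (intro \<delta>(2)) auto
      moreover have "L ?y \<tau> \<le> ell i ?y \<tau>"
        using \<tau> t by (intro L_le[OF i \<open>?y \<in> ray e i\<close>]) auto
      ultimately show "L ?y \<tau> \<le> ell i (r *\<^sub>R e i) t + \<epsilon>"
        by linarith
    qed (use \<delta> in simp)
  qed
  show ?thesis
    by (rule subsolution_along_constant_control[OF C1 max i r t _ _ h1 adm run])
      (use i in \<open>auto simp: fdyn_def\<close>)
qed

text \<open>The test control \<open>- Dx i\<close> is the maximizer in the edge Hamiltonian.\<close>

lemma subsolution_edge:
  assumes C1: "C1_net N e T \<phi> Dx Dt" and max: "loc_max_net N e T (\<lambda>y s. u y s - \<phi> y s) x t"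
    and i: "i \<in> {1..N}" and x: "x \<in> ray e i" "x \<noteq> 0" and t: "t \<in> {0<..<T}"
  shows "- Dt i (norm x, t) + Hedge (ell i x t) (Dx i (norm x, t)) \<le> 0"
proof -
  have x_eq: "norm x *\<^sub>R e i = x"
    using ray_iff[OF i] x by metis
  have "loc_max_net N e T (\<lambda>y s. u y s - \<phi> y s) (norm x *\<^sub>R e i) t"
    unfolding x_eq by (rule max)
  from subsolution_edge_control[OF C1 this i _ t, of "- Dx i (norm x, t)"]
  show ?thesis
    using x by (simp add: x_eq Hedge_def power2_eq_square)
qed

text \<open>\<open>HO\<close> is a maximum, so each entry is tested separately: the maximizer of
  \<open>Hdown\<close> on every edge, and the waiting control for \<open>- ellO\<close>.\<close>

lemma subsolution_vertex:
  assumes C1: "C1_net N e T \<phi> Dx Dt" and max: "loc_max_net N e T (\<lambda>y s. u y s - \<phi> y s) 0 t"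
    and t: "t \<in> {0<..<T}"
  shows "- Dt 1 (0, t) + HO N (ellO t) (\<lambda>i. ell i 0 t) (\<lambda>i. Dx i (0, t)) \<le> 0"
proof -
  have one: "1 \<in> {1..N}"
    using N_pos by simp
  have "- Dt 1 (0, t) + Hdown (ell i 0 t) (Dx i (0, t)) \<le> 0" if i: "i \<in> {1..N}" for i
  proof -
    let ?a = "max 0 (- Dx i (0, t))"
    have "loc_max_net N e T (\<lambda>y s. u y s - \<phi> y s) (0 *\<^sub>R e i) t"
      using max by simp
    from subsolution_edge_control[OF C1 this i order_refl t, of ?a]
    have "- Dt i (0, t) - ?a * Dx i (0, t) - ?a\<^sup>2 / 2 - ell i 0 t \<le> 0"
      by simp
    moreover have "- ?a * Dx i (0, t) = ?a\<^sup>2"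
      by (auto simp: max_def power2_eq_square)
    ultimately show ?thesis
      using C1_net_Dt_vertex[OF C1 one i t] by (simp add: Hdown_eq)
  qed
  moreover have "- Dt 1 (0, t) - ellO t \<le> 0"
  proof -
    have max': "loc_max_net N e T (\<lambda>y s. u y s - \<phi> y s) (0 *\<^sub>R e 1) t"
      using max by simp
    have "\<exists>h>0. \<forall>\<tau>\<in>{t..<t+h}. \<tau> \<le> T \<longrightarrow> 0 + (\<tau> - t) * 0 \<ge> 0 \<longrightarrow>
        L ((0 + (\<tau> - t) * 0) *\<^sub>R e 1) \<tau> \<le> ellO t + \<epsilon>" if \<epsilon>: "\<epsilon> > 0" for \<epsilon>
    proof -
      from ellO_near[OF _ \<epsilon>, of t] t obtain \<delta> where \<delta>: "\<delta> > 0"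
        "\<And>s. s \<in> {0..T} \<Longrightarrow> \<bar>s - t\<bar> < \<delta> \<Longrightarrow> \<bar>ellO s - ellO t\<bar> < \<epsilon>"
        by auto
      have "ellO \<tau> \<le> ellO t + \<epsilon>" if "\<tau> \<in> {t..<t+\<delta>}" "\<tau> \<le> T" for \<tau>
        using \<delta>(2)[of \<tau>] that t by auto
      then show ?thesis
        using \<delta>(1) by (intro exI[of _ \<delta>]) (auto simp: L_def)
    qed
    from subsolution_along_constant_control[OF C1 max' one order_refl t, of 0 0 0 1, OF _ _ _ _ this]
    show ?thesis
      by (simp add: fdyn_def)
  qed
  ultimately have "HO N (ellO t) (\<lambda>i. ell i 0 t) (\<lambda>i. Dx i (0, t)) \<le> Dt 1 (0, t)"
    using N_pos by (subst HO_le_iff) auto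
  then show ?thesis
    by simp
qed

section \<open>Supersolution property\<close>

text \<open>For a short time a near-optimal path stays closer to \<open>x\<close> than the vertex
  is, hence on the same edge, where the running cost is continuous. Young's inequality with slope
  \<open>\<bar>p\<bar> + \<epsilon>\<close> then trades its energy for displacement.\<close>

lemma supersolution_edge:
  assumes C1: "C1_net N e T \<phi> Dx Dt" and min: "loc_min_net N e T (\<lambda>y s. u y s - \<phi> y s) x t"
    and i: "i \<in> {1..N}" and x: "x \<in> ray e i" "x \<noteq> 0" and t: "t \<in> {0<..<T}"
  shows "0 \<le> - Dt i (norm x, t) + Hedge (ell i x t) (Dx i (norm x, t))"
proof -
  define r where "r = norm x"
  define p where "p = Dx i (r, t)"
  define q where "q = Dt i (r, t)"
  define l where "l = ell i x t"
  have r: "r > 0" and x_eq: "x = r *\<^sub>R e i"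
    using x ray_iff[OF i] by (auto simp: r_def)
  have xG: "x \<in> Gnet N e"
    using ray_subset_Gnet[OF i] x by blast
  have t0: "t \<in> {0..T}" "0 \<le> t" "t < T"
    using t by auto
  have "q + l \<le> p\<^sup>2 / 2"
  proof (rule le_of_le_add_mult[of _ _ "\<bar>p\<bar> + 4"])
    fix \<epsilon> :: real assume \<epsilon>: "0 < \<epsilon>" "\<epsilon> \<le> 1"
    obtain \<delta>1 where \<delta>1: "\<delta>1 > 0" and expand:
      "\<And>r' s. r' \<ge> 0 \<Longrightarrow> s \<in> {0..T} \<Longrightarrow> \<bar>r' - r\<bar> < \<delta>1 \<Longrightarrow> \<bar>s - t\<bar> < \<delta>1 \<Longrightarrow>
        \<bar>\<phi> (r' *\<^sub>R e i) s - \<phi> (r *\<^sub>R e i) t - (p * (r' - r) + q * (s - t))\<bar>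
          \<le> \<epsilon> * (\<bar>r' - r\<bar> + \<bar>s - t\<bar>)"
      using C1_net_expansion[OF C1 i less_imp_le[OF r] t0(1) \<epsilon>(1)] unfolding p_def q_def by auto
    obtain \<delta>2 where \<delta>2: "\<delta>2 > 0" "\<And>y s. y \<in> Gnet N e \<Longrightarrow> s \<in> {0..T} \<Longrightarrow> norm (y - x) < \<delta>2 \<Longrightarrow>
        \<bar>s - t\<bar> < \<delta>2 \<Longrightarrow> \<bar>ell i y s - l\<bar> < \<epsilon>"
      using ell_near[OF i xG t0(1) \<epsilon>(1)] unfolding l_def by auto
    obtain d where d: "d > 0" "\<And>y s. y \<in> Gnet N e \<Longrightarrow> s \<in> {0..T} \<Longrightarrow> gdist N e y x < d \<Longrightarrow>
        \<bar>s - t\<bar> < d \<Longrightarrow> u x t - \<phi> x t \<le> u y s - \<phi> y s"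
      using min unfolding loc_min_net_def by blast
    define \<eta> where "\<eta> = Min {\<epsilon>, \<delta>1, \<delta>2, d, r}"
    have \<eta>: "\<eta> > 0" "\<eta> \<le> \<epsilon>" "\<eta> \<le> \<delta>1" "\<eta> \<le> \<delta>2" "\<eta> \<le> d" "\<eta> \<le> r"
      using \<epsilon> \<delta>1 \<delta>2 d r by (auto simp: \<eta>_def)
    obtain h y \<alpha> where h: "0 < h" "h < \<eta>" and hT: "t + h < T" and G: "(y, \<alpha>) \<in> Gamma N e T t x"
      and close: "\<And>s. s \<in> {t..t+h} \<Longrightarrow> norm (y s - x) < \<eta>"
      and opt: "cost y \<alpha> t (t + h) + u (y (t + h)) (t + h) \<le> u x t + \<eta> * h"
      by (rule almost_optimal_short_time[OF t0(2,3) xG \<eta>(1)]) blast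
    define z where "z = y (t + h)"
    define E where "E = (LINT \<tau>:{t..t+h}|lborel. (snd (\<alpha> \<tau>))\<^sup>2 / 2)"
    have yG: "y \<tau> \<in> Gnet N e" and y0: "y \<tau> \<noteq> 0" if "\<tau> \<in> {t..t+h}" for \<tau>
      using GammaD(5)[OF G, of \<tau>] close[OF that] that hT \<eta>(6) by (auto simp: r_def)
    have yt: "y t = x"
      using Gamma_initial[OF G] t0 by simp
    have yray: "y \<tau> \<in> ray e i" if "\<tau> \<in> {t..t+h}" for \<tau>
    proof (rule path_stays_on_ray[of "{t..t+h}" y i t])
      show "continuous_on {t..t+h} y"
        by (rule continuous_on_subset[OF Gamma_continuous[OF G]]) (use hT in auto)
    qed (use yG y0 i yt x h that in auto)
    have "l - \<epsilon> \<le> L (y \<tau>) \<tau>" if "\<tau> \<in> {t<..t+h}" for \<tau>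
      using \<delta>2(2)[of "y \<tau>" \<tau>] L_eq[OF i yray y0, of \<tau>] yG[of \<tau>] close[of \<tau>] that hT t0 h \<eta> by auto
    from cost_ge[where b = "t + h", OF G t0(2) order_refl order_refl _ _ this]
    have cost: "h * (l - \<epsilon>) + E \<le> cost y \<alpha> t (t + h)"
      using h hT by (simp add: E_def)
    have z: "z \<in> ray e i" "z \<in> Gnet N e" "norm (z - x) < \<eta>"
      using yray yG close h by (auto simp: z_def)
    have z_eq: "z = norm z *\<^sub>R e i"
      using z ray_iff[OF i] by blast
    have "z - x = (norm z - r) *\<^sub>R e i"
      using z_eq x_eq by (metis scaleR_left_diff_distrib)
    then have rho: "norm (z - x) = \<bar>norm z - r\<bar>"
      using norm_e[OF i] by simp
    have disp: "(\<bar>p\<bar> + \<epsilon>) * norm (z - x) \<le> E + h * ((\<bar>p\<bar> + \<epsilon>)\<^sup>2 / 2)"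
      using Gamma_displacement[OF G order_refl, of "t + h" "\<bar>p\<bar> + \<epsilon>"] h hT \<epsilon> yt
      by (simp add: z_def E_def)
    have "u x t - \<phi> x t \<le> u z (t + h) - \<phi> z (t + h)"
      using d(2)[of z "t + h"] gdist_same_ray[OF i z(1) x(1)] z \<eta> h hT t0 by (simp add: dist_norm)
    moreover have "\<bar>\<phi> z (t + h) - \<phi> x t - (p * (norm z - r) + q * h)\<bar> \<le> \<epsilon> * (norm (z - x) + h)"
      using expand[of "norm z" "t + h"] z_eq x_eq rho z \<eta> h hT t0 by simp
    moreover have "- \<bar>p\<bar> * norm (z - x) \<le> p * (norm z - r)"
      unfolding rho using abs_ge_minus_self[of "p * (norm z - r)"] by (simp add: abs_mult)
    moreover have "\<eta> * h \<le> \<epsilon> * h"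
      using \<eta> h by (intro mult_right_mono) auto
    \<comment> \<open>The displacement terms cancel by the choice of slope. The three
      \<open>\<epsilon>\<close> come from the running cost, the near-optimality and the time part of
      the expansion.\<close>
    ultimately have "h * (q + l) \<le> h * ((\<bar>p\<bar> + \<epsilon>)\<^sup>2 / 2 + 3 * \<epsilon>)"
      using opt cost disp unfolding z_def[symmetric] by (simp add: algebra_simps)
    then have "q + l \<le> (\<bar>p\<bar> + \<epsilon>)\<^sup>2 / 2 + 3 * \<epsilon>"
      using h(1) by (simp only: mult_le_cancel_left_pos)
    moreover have "(A + \<epsilon>)\<^sup>2 / 2 + 3 * \<epsilon> \<le> A\<^sup>2 / 2 + \<epsilon> * (A + 4)" for A :: real
    proof -
      have "\<epsilon> * \<epsilon> \<le> \<epsilon> * 1"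
        using \<epsilon> by (intro mult_left_mono) auto
      moreover have "(A + \<epsilon>)\<^sup>2 = A\<^sup>2 + 2 * (\<epsilon> * A) + \<epsilon> * \<epsilon>" "\<epsilon> * (A + 4) = \<epsilon> * A + 4 * \<epsilon>"
        by (simp_all add: power2_eq_square algebra_simps)
      ultimately show ?thesis
        using \<epsilon>(1) by (simp add: add_divide_distrib)
    qed
    ultimately show "q + l \<le> p\<^sup>2 / 2 + \<epsilon> * (\<bar>p\<bar> + 4)"
      using order_trans[of "q + l"] power2_abs[of p] by metis
  qed
  then show ?thesis
    by (simp add: Hedge_def p_def q_def l_def r_def)
qed

text \<open>An almost optimal path from the vertex may run through several edges, but only its
  last excursion, after the last visit \<open>\<sigma>\<close> to the vertex, contributes to the displacement.
  Before \<open>\<sigma>\<close> the running cost is bounded below by \<open>ellO\<close>, whichever edges are visited.\<close>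

lemma supersolution_vertex:
  assumes C1: "C1_net N e T \<phi> Dx Dt" and min: "loc_min_net N e T (\<lambda>y s. u y s - \<phi> y s) 0 t"
    and t: "t \<in> {0<..<T}"
  shows "0 \<le> - Dt 1 (0, t) + HO N (ellO t) (\<lambda>i. ell i 0 t) (\<lambda>i. Dx i (0, t))"
proof -
  define p where "p = (\<lambda>i. Dx i (0, t))"
  define q where "q = Dt 1 (0, t)"
  define H where "H = HO N (ellO t) (\<lambda>i. ell i 0 t) p"
  \<comment> \<open>The final edge \<open>j\<close> depends on \<open>\<epsilon>\<close>, so the
    constant multiplying \<open>\<epsilon>\<close> must be uniform over the edges.\<close>
  define P where "P = (\<Sum>i\<in>{1..N}. \<bar>p i\<bar>)"
  have q: "Dt i (0, t) = q" if "i \<in> {1..N}" for i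
    using C1_net_Dt_vertex[OF C1 that _ t, of 1] N_pos by (simp add: q_def)
  have H: "- ellO t \<le> H" "\<And>i. i \<in> {1..N} \<Longrightarrow> Hdown (ell i 0 t) (p i) \<le> H"
    using HO_le_iff[OF N_pos, of "ellO t" "\<lambda>i. ell i 0 t" p H] by (auto simp: H_def)
  have P: "\<bar>p i\<bar> \<le> P" if "i \<in> {1..N}" for i
    unfolding P_def using that by (intro member_le_sum) auto
  have t0: "t \<in> {0..T}" "0 \<le> t" "t < T"
    using t by auto
  have "q \<le> H"
  proof (rule le_of_le_add_mult[of _ _ "P + 4"])
    fix \<epsilon> :: real assume \<epsilon>: "0 < \<epsilon>" "\<epsilon> \<le> 1"
    have "\<exists>\<delta>>0. \<forall>i\<in>{1..N}. \<forall>r' s. r' \<ge> 0 \<longrightarrow> s \<in> {0..T} \<longrightarrow> r' < \<delta> \<longrightarrow> \<bar>s - t\<bar> < \<delta> \<longrightarrow>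
        \<bar>\<phi> (r' *\<^sub>R e i) s - \<phi> 0 t - (p i * r' + q * (s - t))\<bar> \<le> \<epsilon> * (r' + \<bar>s - t\<bar>)"
    proof (rule finite_common_radius, goal_cases)
      case (2 i)
      obtain \<delta> where "\<delta> > 0" "\<And>r' s. r' \<ge> 0 \<Longrightarrow> s \<in> {0..T} \<Longrightarrow> \<bar>r' - 0\<bar> < \<delta> \<Longrightarrow> \<bar>s - t\<bar> < \<delta> \<Longrightarrow>
          \<bar>\<phi> (r' *\<^sub>R e i) s - \<phi> (0 *\<^sub>R e i) t - (p i * (r' - 0) + q * (s - t))\<bar>
            \<le> \<epsilon> * (\<bar>r' - 0\<bar> + \<bar>s - t\<bar>)"
        using C1_net_expansion[OF C1 2 order_refl t0(1) \<epsilon>(1)] q[OF 2] unfolding p_def by metis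
      then show ?case
        by (intro exI[of _ \<delta>]) simp
    next
      case (3 i \<delta> \<delta>')
      then show ?case
        by (meson less_le_trans)
    qed simp
    then obtain \<delta>1 where \<delta>1: "\<delta>1 > 0" and expand:
      "\<And>i r' s. i \<in> {1..N} \<Longrightarrow> r' \<ge> 0 \<Longrightarrow> s \<in> {0..T} \<Longrightarrow> r' < \<delta>1 \<Longrightarrow> \<bar>s - t\<bar> < \<delta>1 \<Longrightarrow>
        \<bar>\<phi> (r' *\<^sub>R e i) s - \<phi> 0 t - (p i * r' + q * (s - t))\<bar> \<le> \<epsilon> * (r' + \<bar>s - t\<bar>)"
      by blast
    have "\<exists>\<delta>>0. \<forall>i\<in>{1..N}. \<forall>y s. y \<in> Gnet N e \<longrightarrow> s \<in> {0..T} \<longrightarrow> norm y < \<delta> \<longrightarrow>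
        \<bar>s - t\<bar> < \<delta> \<longrightarrow> \<bar>ell i y s - ell i 0 t\<bar> < \<epsilon>"
    proof (rule finite_common_radius, goal_cases)
      case (2 i)
      obtain \<delta> where "\<delta> > 0" "\<And>y s. y \<in> Gnet N e \<Longrightarrow> s \<in> {0..T} \<Longrightarrow> norm (y - 0) < \<delta> \<Longrightarrow>
          \<bar>s - t\<bar> < \<delta> \<Longrightarrow> \<bar>ell i y s - ell i 0 t\<bar> < \<epsilon>"
        using ell_near[OF 2 zero_mem_Gnet t0(1) \<epsilon>(1)] by metis
      then show ?case
        by (intro exI[of _ \<delta>]) simp
    next
      case (3 i \<delta> \<delta>')
      then show ?case
        by (meson less_le_trans)
    qed simp
    then obtain \<delta>2 where \<delta>2: "\<delta>2 > 0" "\<And>i y s. i \<in> {1..N} \<Longrightarrow> y \<in> Gnet N e \<Longrightarrow> s \<in> {0..T} \<Longrightarrow>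
        norm y < \<delta>2 \<Longrightarrow> \<bar>s - t\<bar> < \<delta>2 \<Longrightarrow> \<bar>ell i y s - ell i 0 t\<bar> < \<epsilon>"
      by blast
    obtain \<delta>3 where \<delta>3: "\<delta>3 > 0"
      "\<And>s. s \<in> {0..T} \<Longrightarrow> \<bar>s - t\<bar> < \<delta>3 \<Longrightarrow> \<bar>ellO s - ellO t\<bar> < \<epsilon>"
      using ellO_near[OF t0(1) \<epsilon>(1)] by auto
    obtain d where d: "d > 0" "\<And>y s. y \<in> Gnet N e \<Longrightarrow> s \<in> {0..T} \<Longrightarrow> norm y < d \<Longrightarrow>
        \<bar>s - t\<bar> < d \<Longrightarrow> u 0 t - \<phi> 0 t \<le> u y s - \<phi> y s"
      using min unfolding loc_min_net_def gdist_zero by blast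
    define \<eta> where "\<eta> = Min {\<epsilon>, \<delta>1, \<delta>2, \<delta>3, d}"
    have \<eta>: "\<eta> > 0" "\<eta> \<le> \<epsilon>" "\<eta> \<le> \<delta>1" "\<eta> \<le> \<delta>2" "\<eta> \<le> \<delta>3" "\<eta> \<le> d"
      using \<epsilon> \<delta>1 \<delta>2 \<delta>3 d by (auto simp: \<eta>_def)
    obtain h y \<alpha> where h: "0 < h" "h < \<eta>" and hT: "t + h < T" and G: "(y, \<alpha>) \<in> Gamma N e T t 0"
      and close0: "\<And>s. s \<in> {t..t+h} \<Longrightarrow> norm (y s - 0) < \<eta>"
      and opt: "cost y \<alpha> t (t + h) + u (y (t + h)) (t + h) \<le> u 0 t + \<eta> * h"
      by (rule almost_optimal_short_time[OF t0(2,3) zero_mem_Gnet \<eta>(1)]) blast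
    have close: "norm (y s) < \<eta>" if "s \<in> {t..t+h}" for s
      using close0[OF that] by simp
    have cont: "continuous_on {t..t+h} y"
      by (rule continuous_on_subset[OF Gamma_continuous[OF G]]) (use hT in auto)
    have yG: "y \<tau> \<in> Gnet N e" if "\<tau> \<in> {t..t+h}" for \<tau>
      using GammaD(5)[OF G, of \<tau>] that hT by auto
    \<comment> \<open>This set of visits is compact and contains \<open>t\<close>, so a last visit
      exists, whatever the path does before it.\<close>
    define Z where "Z = {s \<in> {t..t+h}. y s = 0}"
    have "closed Z"
      unfolding Z_def by (rule continuous_closed_preimage_constant[OF cont]) simp
    moreover have "bounded Z"
      by (rule bounded_subset[of "{t..t+h}"]) (auto simp: Z_def)
    moreover have "t \<in> Z"
      using Gamma_initial[OF G] t0 h by (simp add: Z_def)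
    ultimately obtain \<sigma> where \<sigma>Z: "\<sigma> \<in> Z" "\<And>s. s \<in> Z \<Longrightarrow> s \<le> \<sigma>"
      using compact_attains_sup[of Z] compact_eq_bounded_closed by blast
    have \<sigma>: "t \<le> \<sigma>" "\<sigma> \<le> t + h" "y \<sigma> = 0"
      using \<sigma>Z by (auto simp: Z_def)
    have after: "y s \<noteq> 0" if "s \<in> {\<sigma><..t+h}" for s
      using \<sigma>Z(2)[of s] that \<sigma> by (auto simp: Z_def)
    define z where "z = y (t + h)"
    define \<kappa> where "\<kappa> = t + h - \<sigma>"
    define E where "E = (LINT \<tau>:{\<sigma>..t+h}|lborel. (snd (\<alpha> \<tau>))\<^sup>2 / 2)"
    have \<kappa>: "0 \<le> \<kappa>" "\<kappa> \<le> h"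
      using \<sigma> by (auto simp: \<kappa>_def)
    have zG: "z \<in> Gnet N e" and z_small: "norm z < \<eta>"
      using yG[of "t + h"] close[of "t + h"] h by (auto simp: z_def)
    obtain j where j: "j \<in> {1..N}" "z \<in> ray e j"
      using zG by (auto simp: Gnet_def)
    \<comment> \<open>If \<open>\<sigma> = t + h\<close> this is vacuous, and any \<open>j\<close>
      will do because \<open>z = 0\<close>.\<close>
    have yray: "y s \<in> ray e j" if "s \<in> {\<sigma><..t+h}" for s
    proof (rule path_stays_on_ray[of "{\<sigma><..t+h}" y j "t + h"])
      show "continuous_on {\<sigma><..t+h} y"
        by (rule continuous_on_subset[OF cont]) (use \<sigma> in auto)
    qed (use yG after j \<sigma> that in \<open>auto simp: z_def\<close>)
    have "ellO t - \<epsilon> \<le> L (y \<tau>) \<tau>" if \<tau>: "\<tau> \<in> {t<..\<sigma>}" for \<tau>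
    proof (cases "y \<tau> = 0")
      case True
      then show ?thesis
        using \<delta>3(2)[of \<tau>] \<tau> \<sigma> h hT t0 \<eta> by (simp add: L_def)
    next
      case False
      obtain i where i: "i \<in> {1..N}" "y \<tau> \<in> ray e i"
        using yG[of \<tau>] \<tau> \<sigma> by (auto simp: Gnet_def)
      have "\<bar>ell i (y \<tau>) \<tau> - ell i 0 t\<bar> < \<epsilon>"
        using \<delta>2(2)[OF i(1) yG, of \<tau> \<tau>] close[of \<tau>] \<tau> \<sigma> h hT t0 \<eta> by auto
      then show ?thesis
        using L_eq[OF i False, of \<tau>] ellO_le[OF i(1) t0(1)] by linarith
    qed
    from cost_ge[OF G t0(2) order_refl order_refl \<sigma>(1) _ this]
    have cost1: "(h - \<kappa>) * (ellO t - \<epsilon>) \<le> cost y \<alpha> t \<sigma>"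
      using energy_nonneg[of t \<sigma> \<alpha>] \<sigma> hT by (simp add: \<kappa>_def)
    have "ell j 0 t - \<epsilon> \<le> L (y \<tau>) \<tau>" if \<tau>: "\<tau> \<in> {\<sigma><..t+h}" for \<tau>
      using \<delta>2(2)[OF j(1) yG, of \<tau> \<tau>] L_eq[OF j(1) yray[OF \<tau>] after[OF \<tau>], of \<tau>]
        close[of \<tau>] \<tau> \<sigma> h hT t0 \<eta> by auto
    from cost_ge[OF G t0(2) order_refl \<sigma>(1,2) _ this]
    have cost2: "\<kappa> * (ell j 0 t - \<epsilon>) + E \<le> cost y \<alpha> \<sigma> (t + h)"
      using hT by (simp add: E_def \<kappa>_def)
    have cost: "cost y \<alpha> t (t + h) = cost y \<alpha> t \<sigma> + cost y \<alpha> \<sigma> (t + h)"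
      using \<sigma> hT t0 by (intro cost_split[OF G]) auto
    \<comment> \<open>Young's inequality needs \<open>a \<ge> 0\<close>, and cancelling the terms in
      \<open>norm z\<close> needs \<open>a \<ge> \<epsilon> - p j\<close>. This is the least such
      slope; as \<open>\<epsilon>\<close> vanishes it becomes the maximizer of
      \<open>Hdown\<close>.\<close>
    define a where "a = max 0 (\<epsilon> - p j)"
    have disp: "a * norm z \<le> E + \<kappa> * (a\<^sup>2 / 2)"
      using Gamma_displacement[OF G \<sigma>(1,2), of a] hT \<sigma>(3) by (simp add: a_def z_def E_def \<kappa>_def)
    have "(\<epsilon> - p j) * norm z \<le> a * norm z"
      by (intro mult_right_mono) (auto simp: a_def)
    moreover have "u 0 t - \<phi> 0 t \<le> u z (t + h) - \<phi> z (t + h)"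
      using d(2)[of z "t + h"] zG z_small \<eta> h hT t0 by simp
    moreover have "\<bar>\<phi> z (t + h) - \<phi> 0 t - (p j * norm z + q * h)\<bar> \<le> \<epsilon> * (norm z + h)"
      using expand[OF j(1), of "norm z" "t + h"] ray_iff[OF j(1), of z] j(2) z_small \<eta> h hT t0 by simp
    moreover have "\<eta> * h \<le> \<epsilon> * h"
      using \<eta> h by (intro mult_right_mono) auto
    \<comment> \<open>The times before and after \<open>\<sigma>\<close> weigh the two kinds of
      entries of \<open>HO\<close>. Up to errors of order \<open>\<epsilon>\<close> both are at most
      \<open>H\<close>, so the unknown split \<open>\<kappa>\<close> drops out.\<close>
    ultimately have main: "h * q \<le> 3 * \<epsilon> * h + (h - \<kappa>) * (- ellO t) + \<kappa> * (a\<^sup>2 / 2 - ell j 0 t)"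
      using opt cost cost1 cost2 disp unfolding z_def[symmetric] by (simp add: algebra_simps)
    have "a\<^sup>2 / 2 - ell j 0 t \<le> H + \<epsilon> * (P + 1)"
    proof -
      let ?m = "max 0 (- p j)"
      have m: "0 \<le> a" "a \<le> ?m + \<epsilon>" "?m \<le> P" "0 \<le> ?m"
        using P[OF j(1)] \<epsilon> by (auto simp: a_def)
      have "a\<^sup>2 \<le> (?m + \<epsilon>)\<^sup>2"
        using m by (intro power_mono) auto
      also have "\<dots> = ?m\<^sup>2 + 2 * (\<epsilon> * ?m) + \<epsilon> * \<epsilon>"
        by (simp add: power2_eq_square algebra_simps)
      also have "\<dots> \<le> ?m\<^sup>2 + 2 * (\<epsilon> * P) + \<epsilon> * 1"
        using m \<epsilon> by (intro add_mono mult_left_mono) auto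
      finally have "a\<^sup>2 / 2 \<le> ?m\<^sup>2 / 2 + \<epsilon> * (P + 1)"
        using \<epsilon> by (simp add: algebra_simps)
      then show ?thesis
        using H(2)[OF j(1)] by (simp add: Hdown_eq)
    qed
    then have "\<kappa> * (a\<^sup>2 / 2 - ell j 0 t) \<le> \<kappa> * (H + \<epsilon> * (P + 1))"
      using \<kappa> by (intro mult_left_mono) auto
    moreover have "\<kappa> * (\<epsilon> * (P + 1)) \<le> h * (\<epsilon> * (P + 1))"
      using \<kappa> \<epsilon> by (intro mult_right_mono) (auto simp: P_def sum_nonneg)
    moreover have "(h - \<kappa>) * (- ellO t) \<le> (h - \<kappa>) * H"
      using \<kappa> H(1) by (intro mult_left_mono) auto
    ultimately have "h * q \<le> h * (H + \<epsilon> * (P + 4))"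
      using main by (simp add: algebra_simps)
    then show "q \<le> H + \<epsilon> * (P + 4)"
      using h(1) by (simp only: mult_le_cancel_left_pos)
  qed
  then show ?thesis
    by (simp add: H_def q_def p_def)
qed

end

section \<open>Costs along the flow of an equilibrium\<close>

text \<open>Evaluation at a point is 1-Lipschitz for the uniform metric.\<close>

lemma measurable_apply_bcontfun:
  fixes \<mu> :: "('b::topological_space \<Rightarrow>\<^sub>C 'c::metric_space) measure"
  assumes "sets \<mu> = sets borel"
  shows "(\<lambda>y. apply_bcontfun y s) \<in> borel_measurable \<mu>"
proof -
  have "continuous_on UNIV (\<lambda>y::'b \<Rightarrow>\<^sub>C 'c. apply_bcontfun y s)"
    unfolding continuous_on_iff using dist_bounded order_le_less_trans by blast
  then show ?thesis
    using borel_measurable_continuous_onI measurable_cong_sets[OF assms refl] by blast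
qed

context network
begin

text \<open>A set outside the sigma-algebra has measure \<open>0\<close> by convention, so the value
  \<open>1\<close> in \<open>PGamma\<close> already carries the measurability of the path
  set.\<close>

lemma PGamma_AE_path:
  assumes "PGamma N e T C \<mu>"
  shows "AE y in \<mu>. \<forall>s\<in>{0..T}. apply_bcontfun y s \<in> Gnet N e"
proof -
  interpret prob_space \<mu>
    using assms by (simp add: PGamma_def)
  have "prob (GammaT_all N e T C) = 1"
    using assms by (simp add: PGamma_def measure_def)
  then have "AE y in \<mu>. y \<in> GammaT_all N e T C"
    by (rule AE_prob_1)
  then show ?thesis
    by eventually_elim (auto simp: GammaT_all_def GammaT_def)
qed

lemma PG_mmu:
  assumes P: "PGamma N e T C \<mu>" and t: "t \<in> {0..T}"
  shows "PG N e (mmu \<mu> t)"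
proof -
  interpret prob_space \<mu>
    using P by (simp add: PGamma_def)
  have m: "(\<lambda>y. apply_bcontfun y t) \<in> borel_measurable \<mu>"
    using P by (intro measurable_apply_bcontfun) (simp add: PGamma_def)
  interpret D: prob_space "mmu \<mu> t"
    unfolding mmu_def by (rule prob_space_distr[OF m])
  have G: "Gnet N e \<in> sets borel"
    using closed_Gnet by (rule borel_closed)
  have "AE x in mmu \<mu> t. x \<in> Gnet N e"
    unfolding mmu_def using PGamma_AE_path[OF P] t G
    by (subst AE_distr_iff[OF m]) (auto elim: eventually_mono)
  then have "emeasure (mmu \<mu> t) (Gnet N e) = 1"
    using G by (intro D.emeasure_eq_1_AE) (simp_all add: mmu_def)
  then show ?thesis
    using D.prob_space_axioms by (simp add: PG_def mmu_def)
qed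

text \<open>Pulled back to path space, the integrands converge because almost every path is
  continuous and stays in the network; boundedness of \<open>f\<close> there gives dominated
  convergence.\<close>

lemma narrow_conv_mmu:
  assumes P: "PGamma N e T C \<mu>" and s: "\<And>n. s n \<in> {0..T}" "t \<in> {0..T}" "s \<longlonglongrightarrow> t"
  shows "narrow_conv N e (\<lambda>n. mmu \<mu> (s n)) (mmu \<mu> t)"
  unfolding narrow_conv_def
proof (intro allI impI)
  fix f :: "'a \<Rightarrow> real"
  assume f: "continuous_on (Gnet N e) f \<and> bounded (f ` Gnet N e)"
  have m: "(\<lambda>y. apply_bcontfun y r) \<in> borel_measurable \<mu>" for r
    using P by (intro measurable_apply_bcontfun) (simp add: PGamma_def)
  interpret prob_space \<mu>
    using P by (simp add: PGamma_def)
  show "(\<lambda>n. LINT x|mmu \<mu> (s n). f x) \<longlonglongrightarrow> (LINT x|mmu \<mu> t. f x)"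
  proof (cases "f \<in> borel_measurable borel")
    case True
    obtain B where B: "\<And>x. x \<in> Gnet N e \<Longrightarrow> \<bar>f x\<bar> \<le> B"
      using f unfolding bounded_iff by auto
    have "(\<lambda>n. LINT y|\<mu>. f (apply_bcontfun y (s n))) \<longlonglongrightarrow> (LINT y|\<mu>. f (apply_bcontfun y t))"
    proof (rule integral_dominated_convergence[where w = "\<lambda>_. B"])
      show "AE y in \<mu>. (\<lambda>n. f (apply_bcontfun y (s n))) \<longlonglongrightarrow> f (apply_bcontfun y t)"
        using PGamma_AE_path[OF P]
      proof eventually_elim
        case (elim y)
        have "(\<lambda>n. apply_bcontfun y (s n)) \<longlonglongrightarrow> apply_bcontfun y t"
          using continuous_on_tendsto_compose[OF continuous_on_apply_bcontfun[of UNIV y] s(3)] by simp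
        then show ?case
          using f elim s by (intro continuous_on_tendsto_compose[of "Gnet N e" f]) auto
      qed
      show "AE y in \<mu>. norm (f (apply_bcontfun y (s n))) \<le> B" for n
        using PGamma_AE_path[OF P] by eventually_elim (use B s in auto)
    qed (use True m in \<open>auto intro: measurable_compose\<close>)
    then show ?thesis
      by (simp add: mmu_def integral_distr[OF m True])
  next
    \<comment> \<open>\<open>f\<close> is only continuous on the network; if it is not Borel, all integrals are \<open>0\<close> by convention.\<close>
    case False
    then have "\<not> integrable (mmu \<mu> r) f" for r
      using borel_measurable_integrable[of "mmu \<mu> r" f] by (auto simp: mmu_def)
    then show ?thesis
      by (simp add: not_integrable_integral_eq)
  qed
qed

text \<open>Time enters twice, through the measure and directly. Along a sequence \<open>p\<close>
  the change of measure is controlled uniformly in the remaining variables, and the limiting measure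
  is then held fixed while \<open>p n\<close> tends to \<open>a\<close>.\<close>

lemma continuous_along_flow:
  fixes F :: "'a measure \<Rightarrow> 'b::metric_space \<Rightarrow> real \<Rightarrow> real"
  assumes P: "PGamma N e T C \<mu>"
    and cont: "\<And>m. PG N e m \<Longrightarrow> continuous_on (S \<times> {0..T}) (\<lambda>(x,t). F m x t)"
    and unif: "\<And>ms m. (\<And>n. PG N e (ms n)) \<Longrightarrow> PG N e m \<Longrightarrow> narrow_conv N e ms m \<Longrightarrow>
      uniform_limit (S \<times> {0..T}) (\<lambda>n (x,t). F (ms n) x t) (\<lambda>(x,t). F m x t) sequentially"
  shows "continuous_on (S \<times> {0..T}) (\<lambda>(x,t). F (mmu \<mu> t) x t)"
  unfolding continuous_on_sequentially
proof (intro allI ballI impI, elim conjE)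
  fix p :: "nat \<Rightarrow> 'b \<times> real" and a
  assume a: "a \<in> S \<times> {0..T}" and p: "\<forall>n. p n \<in> S \<times> {0..T}" and lim: "p \<longlonglongrightarrow> a"
  let ?F = "\<lambda>m q. F m (fst q) (snd q)"
  have PGs: "PG N e (mmu \<mu> (snd (p n)))" and PGa: "PG N e (mmu \<mu> (snd a))" for n
    using PG_mmu[OF P] p a by (auto simp: mem_Times_iff)
  have "narrow_conv N e (\<lambda>n. mmu \<mu> (snd (p n))) (mmu \<mu> (snd a))"
    using p a lim by (intro narrow_conv_mmu[OF P]) (auto simp: mem_Times_iff intro: tendsto_snd)
  from unif[OF PGs PGa this]
  have "\<forall>\<epsilon>>0. \<forall>\<^sub>F n in sequentially. \<forall>q\<in>S \<times> {0..T}.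
      dist (?F (mmu \<mu> (snd (p n))) q) (?F (mmu \<mu> (snd a)) q) < \<epsilon>"
    by (simp add: uniform_limit_iff case_prod_beta)
  then have "\<forall>\<epsilon>>0. \<forall>\<^sub>F n in sequentially.
      dist (?F (mmu \<mu> (snd (p n))) (p n) - ?F (mmu \<mu> (snd a)) (p n)) 0 < \<epsilon>"
    using p by (fastforce simp: dist_real_def elim: eventually_mono)
  then have "(\<lambda>n. ?F (mmu \<mu> (snd (p n))) (p n) - ?F (mmu \<mu> (snd a)) (p n)) \<longlonglongrightarrow> 0"
    by (simp only: tendsto_iff)
  moreover have "(\<lambda>n. ?F (mmu \<mu> (snd a)) (p n)) \<longlonglongrightarrow> ?F (mmu \<mu> (snd a)) a"
  proof (rule continuous_on_tendsto_compose[OF _ lim a])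
    show "continuous_on (S \<times> {0..T}) (?F (mmu \<mu> (snd a)))"
      using cont[OF PGa] by (simp add: case_prod_beta)
    show "\<forall>\<^sub>F n in sequentially. p n \<in> S \<times> {0..T}"
      using p by (intro always_eventually)
  qed
  ultimately have "(\<lambda>n. ?F (mmu \<mu> (snd (p n))) (p n)) \<longlonglongrightarrow> ?F (mmu \<mu> (snd a)) a"
    by (rule Lim_transform[rotated])
  then show "((\<lambda>(x,t). F (mmu \<mu> t) x t) \<circ> p) \<longlonglongrightarrow> (\<lambda>(x,t). F (mmu \<mu> t) x t) a"
    by (simp add: o_def case_prod_beta)
qed

end

lemma continuous_on_Min_finite:
  fixes f :: "'i \<Rightarrow> 'b::topological_space \<Rightarrow> 'c::linorder_topology"
  assumes "finite I" "I \<noteq> {}" "\<And>i. i \<in> I \<Longrightarrow> continuous_on S (f i)"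
  shows "continuous_on S (\<lambda>x. Min ((\<lambda>i. f i x) ` I))"
  using assms
proof (induction I rule: finite_ne_induct)
  case (insert i I)
  then show ?case
    by (simp add: continuous_on_min)
qed simp

lemma abs_Min_le:
  fixes f :: "'i \<Rightarrow> real"
  assumes "finite I" "I \<noteq> {}" "\<And>i. i \<in> I \<Longrightarrow> \<bar>f i\<bar> \<le> K"
  shows "\<bar>Min (f ` I)\<bar> \<le> K"
proof -
  have "Min (f ` I) \<in> f ` I"
    using assms by (intro Min_in) auto
  then obtain i where "i \<in> I" "Min (f ` I) = f i"
    by blast
  then show ?thesis
    using assms(3) by simp
qed

lemma network_control_MFG:
  fixes N :: nat and e :: "nat \<Rightarrow> 'a::euclidean_space" and T :: real
  assumes net: "network N e" and T: "T > 0"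
    and costs: "MFG_costs N e T Li Ls Gi Gs" and H1: "H_MFG1 N e T Li Ls Gi Gs"
    and P: "PGamma N e T C \<mu>"
  shows "\<exists>K. network_control N e T K (\<lambda>i x t. Li i (mmu \<mu> t) x t)
    (\<lambda>t. min (Ls (mmu \<mu> t) t) (Min ((\<lambda>i. Li i (mmu \<mu> t) 0 t) ` {1..N})))
    (gnet N e Gi Gs (mmu \<mu> T))"
proof -
  interpret network N e
    by (rule net)
  have ne: "finite {1..N}" "{1..N} \<noteq> {}"
    using N_pos by auto
  have PGt: "PG N e (mmu \<mu> t)" if "t \<in> {0..T}" for t
    using PG_mmu[OF P that] .
  obtain K where K: "\<And>m. PG N e m \<Longrightarrow> (\<forall>t\<in>{0..T}. \<bar>Ls m t\<bar> \<le> K) \<and> \<bar>Gs m\<bar> \<le> K \<and>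
        (\<forall>i\<in>{1..N}. \<forall>x\<in>Gnet N e. \<bar>Gi i m x\<bar> \<le> K \<and> (\<forall>t\<in>{0..T}. \<bar>Li i m x t\<bar> \<le> K))"
    using H1 unfolding H_MFG1_def by blast
  have Li: "continuous_on (Gnet N e \<times> {0..T}) (\<lambda>(x,t). Li i (mmu \<mu> t) x t)" if "i \<in> {1..N}" for i
  proof (rule continuous_along_flow[OF P])
    show "continuous_on (Gnet N e \<times> {0..T}) (\<lambda>(x,t). Li i m x t)" if "PG N e m" for m
      using costs \<open>i \<in> {1..N}\<close> that unfolding MFG_costs_def by blast
    show "uniform_limit (Gnet N e \<times> {0..T}) (\<lambda>n (x,t). Li i (ms n) x t) (\<lambda>(x,t). Li i m x t) sequentially"
      if "\<And>n. PG N e (ms n)" "PG N e m" "narrow_conv N e ms m" for ms m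
      using costs \<open>i \<in> {1..N}\<close> that unfolding MFG_costs_def by blast
  qed
  \<comment> \<open>The vertex cost has no space variable; a dummy one over a single point brings it
    under \<open>continuous_along_flow\<close>.\<close>
  have "continuous_on ({0::real} \<times> {0..T}) (\<lambda>(x,t). (\<lambda>m _. Ls m) (mmu \<mu> t) x t)"
  proof (rule continuous_along_flow[OF P])
    fix m assume "PG N e m"
    then have "continuous_on {0..T} (Ls m)"
      using costs unfolding MFG_costs_def by blast
    then show "continuous_on ({0::real} \<times> {0..T}) (\<lambda>(x,t). Ls m t)"
      unfolding case_prod_beta by (rule continuous_on_compose2) (auto intro!: continuous_intros)
  next
    fix ms m
    assume "\<And>n. PG N e (ms n)" "PG N e m" "narrow_conv N e ms m"
    then have "uniform_limit {0..T} (\<lambda>n. Ls (ms n)) (Ls m) sequentially"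
      using costs unfolding MFG_costs_def by blast
    then show "uniform_limit ({0::real} \<times> {0..T}) (\<lambda>n (x,t). Ls (ms n) t) (\<lambda>(x,t). Ls m t) sequentially"
      by (simp add: uniform_limit_iff)
  qed
  then have "continuous_on {0..T} (\<lambda>t. (\<lambda>(x::real,t). Ls (mmu \<mu> t) t) (0, t))"
    by (rule continuous_on_compose2) (auto intro!: continuous_intros)
  then have Ls: "continuous_on {0..T} (\<lambda>t. Ls (mmu \<mu> t) t)"
    by simp
  have Li0: "continuous_on {0..T} (\<lambda>t. Li i (mmu \<mu> t) 0 t)" if "i \<in> {1..N}" for i
  proof -
    have "continuous_on {0..T} (\<lambda>t. (\<lambda>(x,t). Li i (mmu \<mu> t) x t) (0, t))"
      by (rule continuous_on_compose2[OF Li[OF that]]) (use zero_mem_Gnet in \<open>auto intro!: continuous_intros\<close>)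
    then show ?thesis
      by simp
  qed
  show ?thesis
  proof (intro exI[of _ K], unfold_locales)
    show "continuous_on (Gnet N e \<times> {0..T}) (\<lambda>(x,t). Li i (mmu \<mu> t) x t)" if "i \<in> {1..N}" for i
      by (rule Li[OF that])
    show "continuous_on {0..T} (\<lambda>t. min (Ls (mmu \<mu> t) t) (Min ((\<lambda>i. Li i (mmu \<mu> t) 0 t) ` {1..N})))"
      by (intro continuous_on_min Ls continuous_on_Min_finite ne Li0)
    show "min (Ls (mmu \<mu> t) t) (Min ((\<lambda>i. Li i (mmu \<mu> t) 0 t) ` {1..N})) \<le> Li i (mmu \<mu> t) 0 t"
      if "i \<in> {1..N}" for i t
      using that by (intro min.coboundedI2 Min_le) auto
    show "\<bar>Li i (mmu \<mu> t) x t\<bar> \<le> K" if "i \<in> {1..N}" "x \<in> Gnet N e" "t \<in> {0..T}" for i x t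
      using K[OF PGt[OF that(3)]] that by blast
    show "\<bar>min (Ls (mmu \<mu> t) t) (Min ((\<lambda>i. Li i (mmu \<mu> t) 0 t) ` {1..N}))\<bar> \<le> K"
      if t: "t \<in> {0..T}" for t
    proof -
      have "\<bar>Min ((\<lambda>i. Li i (mmu \<mu> t) 0 t) ` {1..N})\<bar> \<le> K"
        using K[OF PGt[OF t]] t zero_mem_Gnet by (intro abs_Min_le ne) blast
      then show ?thesis
        using K[OF PGt[OF t]] t by (simp add: min_def)
    qed
    show "\<bar>gnet N e Gi Gs (mmu \<mu> T) x\<bar> \<le> K" if x: "x \<in> Gnet N e" for x
    proof (cases "x = 0")
      case True
      note KT = K[OF PGt, of T]
      have "\<bar>Min ((\<lambda>i. Gi i (mmu \<mu> T) 0) ` {1..N})\<bar> \<le> K"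
        using KT T zero_mem_Gnet by (intro abs_Min_le ne) auto
      then show ?thesis
        using KT T True by (simp add: gnet_def min_def)
    next
      case False
      obtain i where i: "i \<in> {1..N}" "x \<in> ray e i"
        using x by (auto simp: Gnet_def)
      then show ?thesis
        using K[OF PGt, of T] T x False edge_idx_eq[OF i] by (simp add: gnet_def)
    qed
  qed
qed

theorem mainTheorem15:
  fixes N :: nat and e :: "nat \<Rightarrow> 'a::euclidean_space" and T :: real
    and Li :: "nat \<Rightarrow> 'a measure \<Rightarrow> 'a \<Rightarrow> real \<Rightarrow> real" and Ls :: "'a measure \<Rightarrow> real \<Rightarrow> real"
    and Gi :: "nat \<Rightarrow> 'a measure \<Rightarrow> 'a \<Rightarrow> real" and Gs :: "'a measure \<Rightarrow> real"
    and m0 :: "'a measure" and Ct C :: real and \<mu> :: "(real \<Rightarrow>\<^sub>C 'a) measure"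
  assumes N2: "N \<ge> 2"
    and unit: "\<forall>i\<in>{1..N}. norm (e i) = 1"
    and distinct: "inj_on e {1..N}"
    and Tpos: "T > 0"
    and costs: "MFG_costs N e T Li Ls Gi Gs"
    and H1: "H_MFG1 N e T Li Ls Gi Gs"
    and H2: "H_MFG2 N e m0"
    and Ct: "Ctilde_prop N e T Li Ls Gi Gs m0 Ct"
    and CCt: "C \<ge> Ct"
    and eq: "MFG_equilibrium N e T Li Ls Gi Gs m0 C \<mu>"
  shows
    "(let ell = (\<lambda>i x t. Li i (mmu \<mu> t) x t);
          lO = (\<lambda>t. min (Ls (mmu \<mu> t) t) (Min ((\<lambda>i. Li i (mmu \<mu> t) 0 t) ` {1..N})));
          g = gnet N e Gi Gs (mmu \<mu> T);
          u = value_fn N e T (\<lambda>x \<tau>. Lnet N e Li Ls (mmu \<mu> \<tau>) x \<tau>) g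
      in (\<forall>x\<in>Gnet N e. u x T = g x) \<and>
         (\<forall>x\<in>Gnet N e. \<forall>t\<in>{0<..<T}. \<forall>\<phi> Dx Dt. C1_net N e T \<phi> Dx Dt \<longrightarrow>
            (loc_max_net N e T (\<lambda>y s. u y s - \<phi> y s) x t \<longrightarrow>
               (x \<noteq> 0 \<longrightarrow> (\<forall>i\<in>{1..N}. x \<in> ray e i \<longrightarrow>
                   - Dt i (norm x, t) + Hedge (ell i x t) (Dx i (norm x, t)) \<le> 0)) \<and>
               (x = 0 \<longrightarrow> - Dt 1 (0, t) + HO N (lO t) (\<lambda>i. ell i 0 t) (\<lambda>i. Dx i (0, t)) \<le> 0)) \<and>
            (loc_min_net N e T (\<lambda>y s. u y s - \<phi> y s) x t \<longrightarrow>
               (x \<noteq> 0 \<longrightarrow> (\<forall>i\<in>{1..N}. x \<in> ray e i \<longrightarrow>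
                   - Dt i (norm x, t) + Hedge (ell i x t) (Dx i (norm x, t)) \<ge> 0)) \<and>
               (x = 0 \<longrightarrow> - Dt 1 (0, t) + HO N (lO t) (\<lambda>i. ell i 0 t) (\<lambda>i. Dx i (0, t)) \<ge> 0))))"
proof -
  let ?ell = "\<lambda>i x t. Li i (mmu \<mu> t) x t"
  let ?lO = "\<lambda>t. min (Ls (mmu \<mu> t) t) (Min ((\<lambda>i. Li i (mmu \<mu> t) 0 t) ` {1..N}))"
  have "network N e"
    using N2 unit distinct by unfold_locales auto
  moreover have "PGamma N e T C \<mu>"
    using eq by (simp add: MFG_equilibrium_def)
  ultimately obtain K where "network_control N e T K ?ell ?lO (gnet N e Gi Gs (mmu \<mu> T))"
    using network_control_MFG Tpos costs H1 by blast
  then interpret network_control N e T K ?ell ?lO "gnet N e Gi Gs (mmu \<mu> T)" .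
  \<comment> \<open>Evaluating the measure argument at \<open>mmu \<mu> \<tau>\<close> turns
    \<open>Lnet\<close> literally into the locale's \<open>L\<close>.\<close>
  have L_eq_Lnet: "(\<lambda>x \<tau>. Lnet N e Li Ls (mmu \<mu> \<tau>) x \<tau>) = L"
    unfolding L_def Lnet_def by (rule refl)
  have "u x T = gnet N e Gi Gs (mmu \<mu> T) x" for x
    by (simp add: value_fn_def)
  then show ?thesis
    unfolding Let_def L_eq_Lnet
    by (intro conjI ballI allI impI)
      (blast, (hypsubst?; rule subsolution_edge subsolution_vertex supersolution_edge supersolution_vertex;
        assumption)+)
qed

end
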